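(* Let $\Omega$ be a bounded spatial domain with sufficiently regular boundary, $T>0$, $0<\alpha<1$, and let $\lambda_1>0$ be the minimal eigenvalue of $-\Delta\omega=\lambda\omega$ in $\Omega$, $\omega=0$ on $\partial\Omega$. Let $\kappa<\lambda_1$. Let $u$ be the solution of $$\partial_t u-\Delta u=\kappa u+f\ \text{ in }\Omega\times(0,T],\qquad u=0\ \text{ on }\partial\Omega\times[0,T],\qquad u(\cdot,0)=u_0,$$ and suppose that $\|\partial_t^k u(t)\|\le M t^{\alpha-k}$ for $k=1,2,3$ and $0<t\le T$, with some constant $M$. For an integer $N\ge1$ put $\tau=T/N$, $t_n=n\tau$, $t_{n-\frac12}=(n-\frac12)\tau$, and let $U^n$ be given by the Crank–Nicolson semi-discrete scheme $$\frac{U^n-U^{n-1}}{\tau}=\Delta U^{n-\frac12}+\kappa U^{n-\frac12}+f(t_{n-\frac12})\ \text{ in }\Omega,\qquad U^n=0\ \text{ on }\partial\Omega,\qquad 1\le n\le N,\qquad U^0=u_0,$$ where $U^{n-\frac12}=\frac12(U^n+U^{n-1})$. Let $e^n=u(\cdot,t_n)-U^n$. Then there is a constant $C_{u,\alpha}>0$, depending on the solution $u$ and on $\alpha$ but not on $n$, $N$ or $\tau$, such that whenever $\tau<1/(\lambda_1-\kappa)$, for all $1\le n\le N$, $$\|e^n\|\le e^{-(\lambda_1-\kappa)t_n}\|e^{0}\|+C_{u,\alpha}\Big(C_9e^{-(\lambda_1-\kappa)t_n/2}\tau^\alpha+C_{10}\,t_n^{\alpha-2}\tau^2\Big),$$ where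 $C_9:=\frac{9}{2-\alpha}+12e^{-(\lambda_1-\kappa)t_n/2}$ and $$C_{10}:=\begin{cases}\frac{1}{2-\alpha}\big(2^{2-\alpha}(1-e^{-7(\lambda_1-\kappa)t_n/12})-1\big), & t_n>-\frac{12}{7(\lambda_1-\kappa)}\ln(1-2^{\alpha-2}),\\ 0,& t_n\le -\frac{12}{7(\lambda_1-\kappa)}\ln(1-2^{\alpha-2}).\end{cases}$$
   Context: $\|\cdot\|$ denotes the $L^2(\Omega)$ norm. The Dirichlet eigenvalue problem has a nondecreasing sequence of positive eigenvalues $\lambda_1\le\lambda_2\le\cdots\to\infty$ whose eigenfunctions form an orthonormal basis of $L^2(\Omega)$. The solution $u$ is continuous from $[0,T]$ into $L^2(\Omega)$ and, on $(0,T]$, three times continuously differentiable in time with values in $L^2(\Omega)$, with $u(t)$ in the domain of the Dirichlet Laplacian; $f$ is the corresponding given source term. The scheme is understood with $U^{n-\frac12}$ in the domain of the Dirichlet Laplacian. The problem data $\Omega,T,\kappa,f,u_0$ (hence $u$) are fixed, and $C_{u,\alpha}$ is a generic constant attached to this fixed solution. *)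

theory Defs
  imports "HOL-Analysis.Analysis"
begin

section \<open>Square-integrable functions on a domain\<close>

text \<open>
  Elements of \<open>L\<^sup>2(\<Omega>)\<close> are represented by functions on the whole space of which only the
  values on \<open>\<Omega>\<close> matter, up to null sets; \<open>L2_norm\<close> is therefore a seminorm on functions, and
  equality in \<open>L\<^sup>2(\<Omega>)\<close> is \<open>AE x in lebesgue_on \<Omega>\<close>.  The codomain is either \<open>real\<close> or, for
  gradients, the space itself.
\<close>

definition L2 :: "'a::euclidean_space set \<Rightarrow> ('a \<Rightarrow> 'b::euclidean_space) set" where
  "L2 \<Omega> = {g. g \<in> borel_measurable (lebesgue_on \<Omega>) \<and>
               integrable (lebesgue_on \<Omega>) (\<lambda>x. (norm (g x))\<^sup>2)}"

definition L2_inner ::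
  "'a::euclidean_space set \<Rightarrow> ('a \<Rightarrow> 'b::euclidean_space) \<Rightarrow> ('a \<Rightarrow> 'b) \<Rightarrow> real" where
  "L2_inner \<Omega> g h = (LINT x|lebesgue_on \<Omega>. g x \<bullet> h x)"

definition L2_norm :: "'a::euclidean_space set \<Rightarrow> ('a \<Rightarrow> 'b::euclidean_space) \<Rightarrow> real" where
  "L2_norm \<Omega> g = sqrt (L2_inner \<Omega> g g)"

definition L2_orthonormal_basis ::
  "'a::euclidean_space set \<Rightarrow> (nat \<Rightarrow> 'a \<Rightarrow> real) \<Rightarrow> bool" where
  "L2_orthonormal_basis \<Omega> \<phi> \<longleftrightarrow>
     (\<forall>j. \<phi> j \<in> L2 \<Omega>) \<and>
     (\<forall>i j. L2_inner \<Omega> (\<phi> i) (\<phi> j) = (if i = j then 1 else 0)) \<and>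
     (\<forall>g\<in>L2 \<Omega>. (\<lambda>n. L2_norm \<Omega> (\<lambda>x. g x - (\<Sum>j<n. L2_inner \<Omega> g (\<phi> j) * \<phi> j x))) \<longlonglongrightarrow> 0)"


section \<open>The Dirichlet Laplacian\<close>

text \<open>\<open>test_function \<Omega> \<phi> D\<close>: \<open>\<phi>\<close> belongs to \<open>C\<^sub>c\<^sup>1(\<Omega>)\<close> (extended by zero) and \<open>D\<close> is its gradient.\<close>

definition test_function ::
  "'a::euclidean_space set \<Rightarrow> ('a \<Rightarrow> real) \<Rightarrow> ('a \<Rightarrow> 'a) \<Rightarrow> bool" where
  "test_function \<Omega> \<phi> D \<longleftrightarrow>
     (\<forall>x. GDERIV \<phi> x :> D x) \<and> continuous_on UNIV D \<and>
     compact (closure {x. \<phi> x \<noteq> 0}) \<and> closure {x. \<phi> x \<noteq> 0} \<subseteq> \<Omega>"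

text \<open>\<open>w \<in> H\<^sup>1(\<Omega>)\<close> with weak gradient \<open>G\<close>; the defining identity is an equation of vectors.\<close>

definition H1_gradient ::
  "'a::euclidean_space set \<Rightarrow> ('a \<Rightarrow> real) \<Rightarrow> ('a \<Rightarrow> 'a) \<Rightarrow> bool" where
  "H1_gradient \<Omega> w G \<longleftrightarrow> w \<in> L2 \<Omega> \<and> G \<in> L2 \<Omega> \<and>
     (\<forall>\<phi> D. test_function \<Omega> \<phi> D \<longrightarrow>
        (LINT x|lebesgue_on \<Omega>. w x *\<^sub>R D x) = - (LINT x|lebesgue_on \<Omega>. \<phi> x *\<^sub>R G x))"

text \<open>
  \<open>w \<in> H\<^sub>0\<^sup>1(\<Omega>)\<close>, the closure of \<open>C\<^sub>c\<^sup>1(\<Omega>)\<close> in \<open>H\<^sup>1(\<Omega>)\<close>, with weak gradient \<open>G\<close>.  This encodes the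
  boundary condition \<open>w = 0\<close> on \<open>\<partial>\<Omega>\<close>.
\<close>

definition H10_gradient ::
  "'a::euclidean_space set \<Rightarrow> ('a \<Rightarrow> real) \<Rightarrow> ('a \<Rightarrow> 'a) \<Rightarrow> bool" where
  "H10_gradient \<Omega> w G \<longleftrightarrow> H1_gradient \<Omega> w G \<and>
     (\<exists>\<phi> D. (\<forall>k::nat. test_function \<Omega> (\<phi> k) (D k)) \<and>
            (\<lambda>k. L2_norm \<Omega> (\<lambda>x. \<phi> k x - w x)) \<longlonglongrightarrow> 0 \<and>
            (\<lambda>k. L2_norm \<Omega> (\<lambda>x. D k x - G x)) \<longlonglongrightarrow> 0)"

text \<open>
  The graph of the Dirichlet Laplacian in \<open>L\<^sup>2(\<Omega>)\<close>: \<open>w\<close> is in the domain (in particular it vanishes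
  on \<open>\<partial>\<Omega>\<close>), and \<open>\<Delta>w = g\<close> holds weakly with \<open>g \<in> L\<^sup>2(\<Omega>)\<close>.
\<close>

definition dirichlet_laplacian ::
  "'a::euclidean_space set \<Rightarrow> ('a \<Rightarrow> real) \<Rightarrow> ('a \<Rightarrow> real) \<Rightarrow> bool" where
  "dirichlet_laplacian \<Omega> w g \<longleftrightarrow> g \<in> L2 \<Omega> \<and>
     (\<exists>G. H10_gradient \<Omega> w G \<and>
          (\<forall>\<phi> D. test_function \<Omega> \<phi> D \<longrightarrow> L2_inner \<Omega> G D = - L2_inner \<Omega> g \<phi>))"

definition dirichlet_eigenfunction ::
  "'a::euclidean_space set \<Rightarrow> real \<Rightarrow> ('a \<Rightarrow> real) \<Rightarrow> bool" where
  "dirichlet_eigenfunction \<Omega> \<mu> \<omega> \<longleftrightarrow>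
     L2_norm \<Omega> \<omega> \<noteq> 0 \<and> dirichlet_laplacian \<Omega> \<omega> (\<lambda>x. - \<mu> * \<omega> x)"

definition dirichlet_eigenvalues :: "'a::euclidean_space set \<Rightarrow> real set" where
  "dirichlet_eigenvalues \<Omega> = {\<mu>. \<exists>\<omega>. dirichlet_eigenfunction \<Omega> \<mu> \<omega>}"

text \<open>
  The spectral property of the Dirichlet problem on \<open>\<Omega>\<close>.  It is the only use made of the regularity
  of \<open>\<partial>\<Omega>\<close> and stands for ``sufficiently regular boundary''.
\<close>

definition dirichlet_spectral_basis :: "'a::euclidean_space set \<Rightarrow> bool" where
  "dirichlet_spectral_basis \<Omega> \<longleftrightarrow>
     (\<exists>(\<mu> :: nat \<Rightarrow> real) \<phi>. mono \<mu> \<and> (\<forall>j. 0 < \<mu> j) \<and> filterlim \<mu> at_top sequentially \<and>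
        (\<forall>j. dirichlet_eigenfunction \<Omega> (\<mu> j) (\<phi> j)) \<and> L2_orthonormal_basis \<Omega> \<phi>)"


section \<open>Time-dependent functions with values in \<open>L\<^sup>2(\<Omega>)\<close>\<close>

definition L2_continuous_on ::
  "'a::euclidean_space set \<Rightarrow> real set \<Rightarrow> (real \<Rightarrow> 'a \<Rightarrow> real) \<Rightarrow> bool" where
  "L2_continuous_on \<Omega> I v \<longleftrightarrow> (\<forall>t\<in>I. v t \<in> L2 \<Omega> \<and>
     ((\<lambda>s. L2_norm \<Omega> (\<lambda>x. v s x - v t x)) \<longlongrightarrow> 0) (at t within I))"

definition L2_has_derivative_on ::
  "'a::euclidean_space set \<Rightarrow> real set \<Rightarrow> (real \<Rightarrow> 'a \<Rightarrow> real) \<Rightarrow> (real \<Rightarrow> 'a \<Rightarrow> real) \<Rightarrow> bool" where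
  "L2_has_derivative_on \<Omega> I v v' \<longleftrightarrow> (\<forall>t\<in>I. v t \<in> L2 \<Omega> \<and> v' t \<in> L2 \<Omega> \<and>
     ((\<lambda>s. L2_norm \<Omega> (\<lambda>x. (v s x - v t x) / (s - t) - v' t x)) \<longlongrightarrow> 0) (at t within I))"

text \<open>\<open>v \<in> C\<^sup>m(I; L\<^sup>2(\<Omega>))\<close>, where \<open>D k\<close> is the \<open>k\<close>-th time derivative of \<open>v\<close> for \<open>k \<le> m\<close>.\<close>

definition L2_Cm_on ::
  "'a::euclidean_space set \<Rightarrow> real set \<Rightarrow> nat \<Rightarrow> (real \<Rightarrow> 'a \<Rightarrow> real) \<Rightarrow>
   (nat \<Rightarrow> real \<Rightarrow> 'a \<Rightarrow> real) \<Rightarrow> bool" where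
  "L2_Cm_on \<Omega> I m v D \<longleftrightarrow> D 0 = v \<and>
     (\<forall>k<m. L2_has_derivative_on \<Omega> I (D k) (D (Suc k))) \<and> L2_continuous_on \<Omega> I (D m)"


section \<open>The parabolic problem and the Crank--Nicolson scheme\<close>

text \<open>
  \<open>u\<close>, with time derivatives \<open>ut k\<close>, solves \<open>\<partial>\<^sub>t u - \<Delta>u = \<kappa>u + f\<close> on \<open>(0,T]\<close> with \<open>u(0) = u\<^sub>0\<close> and
  homogeneous Dirichlet conditions.  Only \<open>u(t)\<close> for \<open>t > 0\<close> has to lie in the domain of the
  Dirichlet Laplacian, \<open>u\<^sub>0\<close> being an arbitrary element of \<open>L\<^sup>2(\<Omega>)\<close>.
\<close>

definition parabolic_solution ::
  "'a::euclidean_space set \<Rightarrow> real \<Rightarrow> real \<Rightarrow> (real \<Rightarrow> 'a \<Rightarrow> real) \<Rightarrow> ('a \<Rightarrow> real) \<Rightarrow>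
   (real \<Rightarrow> 'a \<Rightarrow> real) \<Rightarrow> (nat \<Rightarrow> real \<Rightarrow> 'a \<Rightarrow> real) \<Rightarrow> bool" where
  "parabolic_solution \<Omega> T \<kappa> f u0 u ut \<longleftrightarrow>
     L2_continuous_on \<Omega> {0..T} u \<and> L2_Cm_on \<Omega> {0<..T} 3 u ut \<and>
     (\<forall>t\<in>{0<..T}. \<exists>g. dirichlet_laplacian \<Omega> (u t) g \<and>
        (AE x in lebesgue_on \<Omega>. ut 1 t x - g x = \<kappa> * u t x + f t x)) \<and>
     (AE x in lebesgue_on \<Omega>. u 0 x = u0 x)"

text \<open>
  The domain condition is imposed on the average of \<open>U n\<close> and \<open>U (n - 1)\<close> only: when \<open>u\<^sub>0\<close> does not
  vanish on \<open>\<partial>\<Omega>\<close>, neither does \<open>U 1\<close>.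
\<close>

definition crank_nicolson ::
  "'a::euclidean_space set \<Rightarrow> real \<Rightarrow> (real \<Rightarrow> 'a \<Rightarrow> real) \<Rightarrow> ('a \<Rightarrow> real) \<Rightarrow> real \<Rightarrow> nat \<Rightarrow>
   (nat \<Rightarrow> 'a \<Rightarrow> real) \<Rightarrow> bool" where
  "crank_nicolson \<Omega> \<kappa> f u0 \<tau> N U \<longleftrightarrow>
     (\<forall>n\<le>N. U n \<in> L2 \<Omega>) \<and>
     (AE x in lebesgue_on \<Omega>. U 0 x = u0 x) \<and>
     (\<forall>n\<in>{1..N}. \<exists>g. dirichlet_laplacian \<Omega> (\<lambda>x. (U n x + U (n - 1) x) / 2) g \<and>
        (AE x in lebesgue_on \<Omega>. (U n x - U (n - 1) x) / \<tau> =
           g x + \<kappa> * ((U n x + U (n - 1) x) / 2) + f ((real n - 1/2) * \<tau>) x))"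

text \<open>In the two constants, \<open>\<delta>\<close> is the spectral gap \<open>\<lambda>\<^sub>1 - \<kappa>\<close> and \<open>t\<close> is the grid point \<open>t\<^sub>n\<close>.\<close>

definition C9 :: "real \<Rightarrow> real \<Rightarrow> real \<Rightarrow> real" where
  "C9 \<alpha> \<delta> t = 9 / (2 - \<alpha>) + 12 * exp (- \<delta> * t / 2)"

definition C10 :: "real \<Rightarrow> real \<Rightarrow> real \<Rightarrow> real" where
  "C10 \<alpha> \<delta> t =
     (if t > - (12 / (7 * \<delta>)) * ln (1 - 2 powr (\<alpha> - 2))
      then 1 / (2 - \<alpha>) * (2 powr (2 - \<alpha>) * (1 - exp (- 7 * \<delta> * t / 12)) - 1)
      else 0)"

end

theory Submission
  imports Defs
begin

text \<open>
  The operator \<open>\<Delta> + \<kappa>\<close> is dissipative, by expansion in the Dirichlet eigenfunctions and \<open>\<kappa> < \<lambda>\<^sub>1\<close>.  The error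
  \<open>e\<^sup>n\<close> is split so that the operator is only ever applied to
  \<open>w = u(t\<^bsub>n-1/2\<^esub>) - U\<^bsup>n-1/2\<^esup>\<close>, which lies in its domain: with the consistency errors
  \<open>R = (u(t\<^sub>n) + u(t\<^bsub>n-1\<^esub>))/2 - u(t\<^bsub>n-1/2\<^esub>)\<close> and
  \<open>\<rho> = u(t\<^sub>n) - u(t\<^bsub>n-1\<^esub>) - \<tau> \<partial>\<^sub>t u(t\<^bsub>n-1/2\<^esub>)\<close>, the functions
  \<open>a = e\<^sup>n - R - \<rho>/2\<close> and \<open>b = e\<^bsup>n-1\<^esup> - R + \<rho>/2\<close> satisfy \<open>a + b = 2w\<close> and
  \<open>a - b = \<tau>(\<Delta> + \<kappa>)w\<close>, so the norm of \<open>a\<close> is at most that of \<open>b\<close>.  Hence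
  each step adds at most \<open>2\<parallel>R\<parallel> + \<parallel>\<rho>\<parallel>\<close>, which is of order \<open>\<tau>\<^sup>\<alpha>\<close> in the first step and
  \<open>\<tau>\<^sup>\<alpha> (n-1)\<^bsup>\<alpha>-2\<^esup>\<close> afterwards.  As this is summable in \<open>n\<close>, the error is \<open>O(\<tau>\<^sup>\<alpha>)\<close>
  uniformly.  On \<open>[0,T]\<close> the factor \<open>C\<^sub>9 exp (- (\<lambda>\<^sub>1 - \<kappa>) t\<^sub>n / 2)\<close> is bounded below by a positive number and
  \<open>C\<^sub>1\<^sub>0 \<ge> 0\<close>, so the \<open>\<tau>\<^sup>\<alpha>\<close> term of the claimed bound alone absorbs this error.
\<close>

section \<open>The semi-inner product on square-integrable functions\<close>

lemma L2_measurable [measurable_dest]: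
  "g \<in> L2 \<Omega> \<Longrightarrow> g \<in> borel_measurable (lebesgue_on \<Omega>)"
  by (simp add: L2_def)

lemma L2_integrable_sq: "g \<in> L2 \<Omega> \<Longrightarrow> integrable (lebesgue_on \<Omega>) (\<lambda>x. (norm (g x))\<^sup>2)"
  by (simp add: L2_def)

lemma integrable_L2_inner:
  assumes "g \<in> L2 \<Omega>" "h \<in> L2 \<Omega>"
  shows "integrable (lebesgue_on \<Omega>) (\<lambda>x. g x \<bullet> h x)"
proof (rule Bochner_Integration.integrable_bound)
  show "integrable (lebesgue_on \<Omega>) (\<lambda>x. (norm (g x))\<^sup>2 + (norm (h x))\<^sup>2)"
    using assms by (intro Bochner_Integration.integrable_add L2_integrable_sq)
  show "(\<lambda>x. g x \<bullet> h x) \<in> borel_measurable (lebesgue_on \<Omega>)"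
    using assms by (intro borel_measurable_inner L2_measurable)
  \<comment> \<open>Young's inequality with the factor 1/2 dropped; any integrable majorant is
    enough here.\<close>
  have "\<bar>a \<bullet> b\<bar> \<le> (norm a)\<^sup>2 + (norm b)\<^sup>2" for a b :: 'b
  proof -
    have "\<bar>a \<bullet> b\<bar> \<le> norm a * norm b"
      by (rule Cauchy_Schwarz_ineq2)
    moreover have "2 * (norm a * norm b) \<le> (norm a)\<^sup>2 + (norm b)\<^sup>2"
      using sum_squares_bound[of "norm a" "norm b"] by simp
    moreover have "0 \<le> norm a * norm b" by simp
    ultimately show ?thesis by linarith
  qed
  then show "AE x in lebesgue_on \<Omega>. norm (g x \<bullet> h x) \<le> norm ((norm (g x))\<^sup>2 + (norm (h x))\<^sup>2)"
    by (intro AE_I2) (simp add: abs_of_nonneg)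
qed

lemma L2_scaleR:
  assumes "g \<in> L2 \<Omega>"
  shows "(\<lambda>x. c *\<^sub>R g x) \<in> L2 \<Omega>"
proof -
  have "integrable (lebesgue_on \<Omega>) (\<lambda>x. c\<^sup>2 * (norm (g x))\<^sup>2)"
    using L2_integrable_sq[OF assms] by (rule integrable_mult_right)
  moreover have "(\<lambda>x. c *\<^sub>R g x) \<in> borel_measurable (lebesgue_on \<Omega>)"
    using L2_measurable[OF assms] by simp
  ultimately show ?thesis
    by (simp add: L2_def power_mult_distrib)
qed

lemma L2_add:
  assumes "g \<in> L2 \<Omega>" "h \<in> L2 \<Omega>"
  shows "(\<lambda>x. g x + h x) \<in> L2 \<Omega>"
proof -
  have "integrable (lebesgue_on \<Omega>) (\<lambda>x. (norm (g x))\<^sup>2 + 2 * (g x \<bullet> h x) + (norm (h x))\<^sup>2)"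
    using assms
    by (intro Bochner_Integration.integrable_add integrable_mult_right L2_integrable_sq
        integrable_L2_inner)
  moreover have "(norm (a + b))\<^sup>2 = (norm a)\<^sup>2 + 2 * (a \<bullet> b) + (norm b)\<^sup>2" for a b :: 'b
    by (simp add: power2_norm_eq_inner inner_add_left inner_add_right inner_commute)
  moreover have "(\<lambda>x. g x + h x) \<in> borel_measurable (lebesgue_on \<Omega>)"
    using assms by (intro borel_measurable_add L2_measurable)
  ultimately show ?thesis
    by (simp add: L2_def)
qed

lemma L2_diff:
  assumes "g \<in> L2 \<Omega>" "h \<in> L2 \<Omega>"
  shows "(\<lambda>x. g x - h x) \<in> L2 \<Omega>"
  using L2_add[OF assms(1) L2_scaleR[OF assms(2), of "-1"]] by simp

lemma L2_mult: "g \<in> L2 \<Omega> \<Longrightarrow> (\<lambda>x. c * g x) \<in> L2 \<Omega>" for g :: "'a::euclidean_space \<Rightarrow> real"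
  using L2_scaleR[of g \<Omega> c] by simp

lemma L2_divide: "g \<in> L2 \<Omega> \<Longrightarrow> (\<lambda>x. g x / c) \<in> L2 \<Omega>" for g :: "'a::euclidean_space \<Rightarrow> real"
  using L2_mult[of g \<Omega> "1 / c"] by simp

lemma L2_zero: "(\<lambda>x. 0) \<in> L2 \<Omega>"
  by (simp add: L2_def)

lemma L2_sum:
  assumes "\<And>i. i \<in> I \<Longrightarrow> g i \<in> L2 \<Omega>"
  shows "(\<lambda>x. \<Sum>i\<in>I. g i x) \<in> L2 \<Omega>"
  using assms by (induction I rule: infinite_finite_induct) (auto intro!: L2_zero L2_add)

section \<open>Bilinearity and the induced seminorm\<close>

lemma L2_inner_commute: "L2_inner \<Omega> g h = L2_inner \<Omega> h g"
  by (simp add: L2_inner_def inner_commute)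

lemma L2_inner_add_left:
  assumes "f \<in> L2 \<Omega>" "g \<in> L2 \<Omega>" "h \<in> L2 \<Omega>"
  shows "L2_inner \<Omega> (\<lambda>x. f x + g x) h = L2_inner \<Omega> f h + L2_inner \<Omega> g h"
  using assms by (simp add: L2_inner_def inner_add_left integrable_L2_inner)

lemma L2_inner_diff_left:
  assumes "f \<in> L2 \<Omega>" "g \<in> L2 \<Omega>" "h \<in> L2 \<Omega>"
  shows "L2_inner \<Omega> (\<lambda>x. f x - g x) h = L2_inner \<Omega> f h - L2_inner \<Omega> g h"
  using assms by (simp add: L2_inner_def inner_diff_left integrable_L2_inner)

lemma L2_inner_mult_left:
  "L2_inner \<Omega> (\<lambda>x. c * g x) h = c * L2_inner \<Omega> g h" for g :: "'a::euclidean_space \<Rightarrow> real"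
  by (simp add: L2_inner_def mult.assoc)

lemma L2_inner_divide_left:
  "L2_inner \<Omega> (\<lambda>x. g x / c) h = L2_inner \<Omega> g h / c" for g :: "'a::euclidean_space \<Rightarrow> real"
  using L2_inner_mult_left[of \<Omega> "1 / c" g h] by simp

lemma L2_inner_sum_left:
  assumes "\<And>i. i \<in> I \<Longrightarrow> g i \<in> L2 \<Omega>" "h \<in> L2 \<Omega>"
  shows "L2_inner \<Omega> (\<lambda>x. \<Sum>i\<in>I. g i x) h = (\<Sum>i\<in>I. L2_inner \<Omega> (g i) h)"
  using assms
  by (induction I rule: infinite_finite_induct)
     (auto simp: L2_inner_add_left L2_sum, auto simp: L2_inner_def)

lemma L2_inner_self_nonneg: "0 \<le> L2_inner \<Omega> g g"
  by (simp add: L2_inner_def)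

lemma L2_norm_nonneg: "0 \<le> L2_norm \<Omega> g"
  by (simp add: L2_norm_def L2_inner_self_nonneg)

lemma L2_norm_power2: "(L2_norm \<Omega> g)\<^sup>2 = L2_inner \<Omega> g g"
  by (simp add: L2_norm_def L2_inner_self_nonneg)

lemma L2_norm_minus_commute: "L2_norm \<Omega> (\<lambda>x. g x - h x) = L2_norm \<Omega> (\<lambda>x. h x - g x)"
proof -
  have "(a - b) \<bullet> (a - b) = (b - a) \<bullet> (b - a)" for a b :: 'b
    by (metis inner_minus_left inner_minus_right minus_diff_eq)
  then show ?thesis
    by (simp add: L2_norm_def L2_inner_def)
qed

lemma L2_norm_mult: "L2_norm \<Omega> (\<lambda>x. c * g x) = \<bar>c\<bar> * L2_norm \<Omega> g"
  for g :: "'a::euclidean_space \<Rightarrow> real"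
proof -
  have "L2_inner \<Omega> (\<lambda>x. c * g x) (\<lambda>x. c * g x) = c\<^sup>2 * L2_inner \<Omega> g g"
    by (simp add: L2_inner_def power2_eq_square mult.assoc mult.left_commute)
  then show ?thesis
    by (simp add: L2_norm_def real_sqrt_mult)
qed

lemma L2_norm_cong_AE:
  assumes "AE x in lebesgue_on \<Omega>. g x = h x" "g \<in> L2 \<Omega>" "h \<in> L2 \<Omega>"
  shows "L2_norm \<Omega> g = L2_norm \<Omega> h"
proof -
  have "L2_inner \<Omega> g g = L2_inner \<Omega> h h"
    unfolding L2_inner_def
    using assms
    by (intro integral_cong_AE borel_measurable_inner L2_measurable) auto
  then show ?thesis by (simp add: L2_norm_def)
qed

text \<open>Nonnegativity of the quadratic polynomial in s given by the squared seminorm of g + s h.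
  The form is only semidefinite on functions, so a vanishing leading coefficient does not make h
  zero and is treated as a separate case.\<close>

lemma L2_Cauchy_Schwarz:
  assumes "g \<in> L2 \<Omega>" "h \<in> L2 \<Omega>"
  shows "\<bar>L2_inner \<Omega> g h\<bar> \<le> L2_norm \<Omega> g * L2_norm \<Omega> h"
proof -
  let ?a = "L2_inner \<Omega> g g" and ?b = "L2_inner \<Omega> g h" and ?c = "L2_inner \<Omega> h h"
  have q: "0 \<le> ?a + 2 * s * ?b + s\<^sup>2 * ?c" for s
  proof -
    have "L2_inner \<Omega> (\<lambda>x. g x + s *\<^sub>R h x) (\<lambda>x. g x + s *\<^sub>R h x)
        = (LINT x|lebesgue_on \<Omega>. g x \<bullet> g x + 2 * s * (g x \<bullet> h x) + s\<^sup>2 * (h x \<bullet> h x))"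
      unfolding L2_inner_def
      by (intro Bochner_Integration.integral_cong refl)
         (simp add: inner_add_left inner_add_right inner_commute power2_eq_square algebra_simps)
    also have "\<dots> = ?a + 2 * s * ?b + s\<^sup>2 * ?c"
      using assms by (simp add: L2_inner_def integrable_L2_inner)
    finally show ?thesis
      using L2_inner_self_nonneg[of \<Omega> "\<lambda>x. g x + s *\<^sub>R h x"] by simp
  qed
  have "?b\<^sup>2 \<le> ?a * ?c"
  proof (cases "?c = 0")
    case True
    have "?b = 0"
    proof (rule ccontr)
      assume "?b \<noteq> 0"
      then show False
        \<comment> \<open>With \<open>?c = 0\<close> the polynomial is affine in s, and at this s it
          takes the value -1.\<close>
        using q[of "- (?a + 1) / (2 * ?b)"] True by (simp add: field_simps)
    qed
    then show ?thesis using True by simp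
  next
    case False
    then have c: "0 < ?c" using L2_inner_self_nonneg[of \<Omega> h] by simp
    \<comment> \<open>The point \<open>- ?b / ?c\<close> is the minimiser of the quadratic.\<close>
    have "?a + 2 * (- ?b / ?c) * ?b + (- ?b / ?c)\<^sup>2 * ?c = ?a - ?b\<^sup>2 / ?c"
      using False by (simp add: power2_eq_square)
    then have "?b\<^sup>2 / ?c \<le> ?a"
      using q[of "- ?b / ?c"] by linarith
    then show ?thesis
      using c by (simp add: pos_divide_le_eq)
  qed
  then have "sqrt (?b\<^sup>2) \<le> sqrt (?a * ?c)"
    by (rule real_sqrt_le_mono)
  then show ?thesis
    by (simp add: L2_norm_def real_sqrt_mult)
qed

lemma L2_norm_triangle:
  assumes "g \<in> L2 \<Omega>" "h \<in> L2 \<Omega>"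
  shows "L2_norm \<Omega> (\<lambda>x. g x + h x) \<le> L2_norm \<Omega> g + L2_norm \<Omega> h"
proof (rule power2_le_imp_le)
  let ?s = "\<lambda>x. g x + h x"
  have "(L2_norm \<Omega> ?s)\<^sup>2 = L2_inner \<Omega> g ?s + L2_inner \<Omega> h ?s"
    using assms L2_add[OF assms] by (simp add: L2_norm_power2 L2_inner_add_left)
  also have "\<dots> = L2_inner \<Omega> ?s g + L2_inner \<Omega> ?s h"
    by (simp only: L2_inner_commute)
  also have "\<dots> = (L2_norm \<Omega> g)\<^sup>2 + 2 * L2_inner \<Omega> g h + (L2_norm \<Omega> h)\<^sup>2"
    using assms L2_inner_commute[of \<Omega> h g] by (simp add: L2_norm_power2 L2_inner_add_left)
  also have "\<dots> \<le> (L2_norm \<Omega> g + L2_norm \<Omega> h)\<^sup>2"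
    using L2_Cauchy_Schwarz[OF assms] by (simp add: power2_sum)
  finally show "(L2_norm \<Omega> (\<lambda>x. g x + h x))\<^sup>2 \<le> (L2_norm \<Omega> g + L2_norm \<Omega> h)\<^sup>2" .
qed (simp add: L2_norm_nonneg)

lemma L2_norm_triangle_diff:
  fixes g h :: "'a::euclidean_space \<Rightarrow> real"
  assumes "g \<in> L2 \<Omega>" "h \<in> L2 \<Omega>"
  shows "L2_norm \<Omega> (\<lambda>x. g x - h x) \<le> L2_norm \<Omega> g + L2_norm \<Omega> h"
  using L2_norm_triangle[OF assms(1) L2_mult[OF assms(2), of "-1"]] L2_norm_mult[of \<Omega> "-1" h]
  by simp

section \<open>Duality, continuity of the inner product and Parseval's identity\<close>

text \<open>Testing with g itself and cancelling one factor. This carries estimates from the scalar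
  functions obtained by pairing with a fixed \<psi> back to the norm, so that calculus is only
  needed for real-valued functions of time.\<close>

lemma L2_norm_le_dual:
  assumes "g \<in> L2 \<Omega>" "0 \<le> B"
    and "\<And>\<psi>. \<psi> \<in> L2 \<Omega> \<Longrightarrow> \<bar>L2_inner \<Omega> g \<psi>\<bar> \<le> B * L2_norm \<Omega> \<psi>"
  shows "L2_norm \<Omega> g \<le> B"
proof (cases "L2_norm \<Omega> g = 0")
  case False
  have "L2_norm \<Omega> g * L2_norm \<Omega> g \<le> B * L2_norm \<Omega> g"
    using assms(3)[OF assms(1)] L2_norm_power2[of \<Omega> g] by (simp add: power2_eq_square)
  then show ?thesis
    using False L2_norm_nonneg[of \<Omega> g] by (simp add: mult_le_cancel_right)
qed (simp add: assms)

text \<open>Cauchy-Schwarz applied to the difference. The filter is left general because the lemma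
  serves sequences (partial sums, approximating test functions) as well as limits in time within an
  interval, where membership in \<open>L2\<close> holds only eventually.\<close>

lemma L2_inner_tendsto:
  assumes "g \<in> L2 \<Omega>" "h \<in> L2 \<Omega>" "eventually (\<lambda>k. a k \<in> L2 \<Omega>) F"
    and "((\<lambda>k. L2_norm \<Omega> (\<lambda>x. a k x - h x)) \<longlongrightarrow> 0) F"
  shows "((\<lambda>k. L2_inner \<Omega> (a k) g) \<longlongrightarrow> L2_inner \<Omega> h g) F"
proof (rule Lim_transform[OF tendsto_const])
  show "((\<lambda>k. L2_inner \<Omega> (a k) g - L2_inner \<Omega> h g) \<longlongrightarrow> 0) F"
  proof (rule Lim_null_comparison)
    show "\<forall>\<^sub>F k in F. norm (L2_inner \<Omega> (a k) g - L2_inner \<Omega> h g)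
        \<le> L2_norm \<Omega> (\<lambda>x. a k x - h x) * L2_norm \<Omega> g"
      using assms(3)
    proof eventually_elim
      case (elim k)
      have "\<bar>L2_inner \<Omega> (\<lambda>x. a k x - h x) g\<bar> \<le> L2_norm \<Omega> (\<lambda>x. a k x - h x) * L2_norm \<Omega> g"
        using elim assms by (intro L2_Cauchy_Schwarz L2_diff)
      then show ?case
        using elim assms by (simp add: L2_inner_diff_left abs_minus_commute)
    qed
    show "((\<lambda>k. L2_norm \<Omega> (\<lambda>x. a k x - h x) * L2_norm \<Omega> g) \<longlongrightarrow> 0) F"
      using assms(4) by (rule tendsto_mult_left_zero)
  qed
qed

text \<open>Parseval's identity: the partial sums of the expansion of g converge in norm, hence also
  after pairing with h.\<close>

lemma L2_basis_inner_sums: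
  assumes "L2_orthonormal_basis \<Omega> \<phi>" "g \<in> L2 \<Omega>" "h \<in> L2 \<Omega>"
  shows "(\<lambda>j. L2_inner \<Omega> g (\<phi> j) * L2_inner \<Omega> h (\<phi> j)) sums L2_inner \<Omega> g h"
proof -
  have \<phi>: "\<phi> j \<in> L2 \<Omega>" for j
    using assms(1) by (simp add: L2_orthonormal_basis_def)
  let ?s = "\<lambda>n x. \<Sum>j<n. L2_inner \<Omega> g (\<phi> j) * \<phi> j x"
  have s: "?s n \<in> L2 \<Omega>" for n
    by (intro L2_sum L2_mult \<phi>)
  have "(\<lambda>n. L2_norm \<Omega> (\<lambda>x. ?s n x - g x)) \<longlonglongrightarrow> 0"
    using assms(1,2) by (subst L2_norm_minus_commute) (simp add: L2_orthonormal_basis_def)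
  then have "(\<lambda>n. L2_inner \<Omega> (?s n) h) \<longlonglongrightarrow> L2_inner \<Omega> g h"
    using assms s by (intro L2_inner_tendsto) auto
  moreover have "L2_inner \<Omega> (?s n) h
      = (\<Sum>j<n. L2_inner \<Omega> g (\<phi> j) * L2_inner \<Omega> h (\<phi> j))" for n
    using assms(3) \<phi>
    by (simp add: L2_inner_sum_left L2_mult L2_inner_mult_left L2_inner_commute[of \<Omega> h])
  ultimately show ?thesis
    by (simp add: sums_def)
qed

section \<open>Dissipativity of the shifted Dirichlet Laplacian\<close>

text \<open>The closure of \<Omega> is compact, so g is bounded there, and a bounded measurable
  function is square-integrable over a set of finite measure.\<close>

lemma continuous_L2:
  assumes "bounded \<Omega>" "open \<Omega>" "continuous_on UNIV g"
  shows "g \<in> L2 \<Omega>"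
proof -
  have g: "g \<in> borel_measurable (lebesgue_on \<Omega>)"
    using assms
    by (intro continuous_imp_measurable_on_sets_lebesgue)
       (auto intro: continuous_on_subset)
  have "compact (closure \<Omega>)"
    using assms(1) by (simp add: compact_closure)
  then have "compact (g ` closure \<Omega>)"
    using assms(3) by (intro compact_continuous_image) (auto intro: continuous_on_subset)
  then obtain B where B: "\<And>x. x \<in> closure \<Omega> \<Longrightarrow> norm (g x) \<le> B"
    by (meson bounded_iff compact_imp_bounded imageI)
  interpret finite_measure "lebesgue_on \<Omega>"
    using assms by (intro finite_measure_lebesgue_on bounded_set_imp_lmeasurable) auto
  have "integrable (lebesgue_on \<Omega>) (\<lambda>x. (norm (g x))\<^sup>2)"
  proof (rule integrable_const_bound)
    show "AE x in lebesgue_on \<Omega>. norm ((norm (g x))\<^sup>2) \<le> B\<^sup>2"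
      using B closure_subset by (intro AE_I2) (auto simp: space_restrict_space intro!: power_mono)
  qed (use g in measurable)
  with g show ?thesis by (simp add: L2_def)
qed

lemma test_function_L2:
  assumes "bounded \<Omega>" "open \<Omega>" "test_function \<Omega> \<phi> D"
  shows "\<phi> \<in> L2 \<Omega>" "D \<in> L2 \<Omega>"
proof -
  have "continuous_on UNIV \<phi>"
    using assms(3)
    by (meson test_function_def continuous_at_imp_continuous_on gderiv_def has_derivative_continuous)
  then show "\<phi> \<in> L2 \<Omega>" using assms by (intro continuous_L2)
  show "D \<in> L2 \<Omega>" using assms by (intro continuous_L2) (simp_all add: test_function_def)
qed

text \<open>Both sides of the weak identity are continuous in the test function for the norm of
  \<open>H\<^sup>1\<close>, so it passes to the limit along the approximating sequence that
  \<open>H10_gradient\<close> provides for v.\<close>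

lemma weak_laplacian_green:
  assumes \<Omega>: "bounded \<Omega>" "open \<Omega>"
    and g: "g \<in> L2 \<Omega>" and G: "G \<in> L2 \<Omega>"
    and weak: "\<And>\<phi> D. test_function \<Omega> \<phi> D \<Longrightarrow> L2_inner \<Omega> G D = - L2_inner \<Omega> g \<phi>"
    and v: "H10_gradient \<Omega> v H"
  shows "L2_inner \<Omega> G H = - L2_inner \<Omega> g v"
proof -
  have vL: "v \<in> L2 \<Omega>" "H \<in> L2 \<Omega>"
    using v by (auto simp: H10_gradient_def H1_gradient_def)
  obtain \<phi> D where *: "\<And>k::nat. test_function \<Omega> (\<phi> k) (D k)"
    "(\<lambda>k. L2_norm \<Omega> (\<lambda>x. \<phi> k x - v x)) \<longlonglongrightarrow> 0"
    "(\<lambda>k. L2_norm \<Omega> (\<lambda>x. D k x - H x)) \<longlonglongrightarrow> 0"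
    using v by (auto simp: H10_gradient_def)
  note L = test_function_L2[OF \<Omega> *(1)]
  have 1: "(\<lambda>k. L2_inner \<Omega> (\<phi> k) g) \<longlonglongrightarrow> L2_inner \<Omega> v g"
    using g vL L *(2) by (intro L2_inner_tendsto) auto
  have 2: "(\<lambda>k. L2_inner \<Omega> (D k) G) \<longlonglongrightarrow> L2_inner \<Omega> H G"
    using G vL L *(3) by (intro L2_inner_tendsto) auto
  have "L2_inner \<Omega> (D k) G = - L2_inner \<Omega> (\<phi> k) g" for k
    using weak[OF *(1)[of k]] by (simp add: L2_inner_commute)
  with 2 have "(\<lambda>k. - L2_inner \<Omega> (\<phi> k) g) \<longlonglongrightarrow> L2_inner \<Omega> H G" by simp
  moreover have "(\<lambda>k. - L2_inner \<Omega> (\<phi> k) g) \<longlonglongrightarrow> - L2_inner \<Omega> v g"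
    using 1 by (rule tendsto_minus)
  ultimately have "L2_inner \<Omega> H G = - L2_inner \<Omega> v g"
    by (rule LIMSEQ_unique)
  then show ?thesis by (simp add: L2_inner_commute)
qed

text \<open>Both sides equal minus the Dirichlet form of w and v: Green's identity is used twice,
  with the roles of w and v exchanged.\<close>

lemma dirichlet_laplacian_symmetric:
  assumes \<Omega>: "bounded \<Omega>" "open \<Omega>"
    and w: "dirichlet_laplacian \<Omega> w g" and v: "dirichlet_laplacian \<Omega> v h"
  shows "L2_inner \<Omega> g v = L2_inner \<Omega> w h"
proof -
  obtain G where G: "g \<in> L2 \<Omega>" "H10_gradient \<Omega> w G"
    "\<And>\<phi> D. test_function \<Omega> \<phi> D \<Longrightarrow> L2_inner \<Omega> G D = - L2_inner \<Omega> g \<phi>"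
    using w by (auto simp: dirichlet_laplacian_def)
  obtain H where H: "h \<in> L2 \<Omega>" "H10_gradient \<Omega> v H"
    "\<And>\<phi> D. test_function \<Omega> \<phi> D \<Longrightarrow> L2_inner \<Omega> H D = - L2_inner \<Omega> h \<phi>"
    using v by (auto simp: dirichlet_laplacian_def)
  have L: "G \<in> L2 \<Omega>" "H \<in> L2 \<Omega>"
    using G(2) H(2) by (auto simp: H10_gradient_def H1_gradient_def)
  have "L2_inner \<Omega> G H = - L2_inner \<Omega> g v"
    using G(1) L(1) G(3) H(2) by (rule weak_laplacian_green[OF \<Omega>])
  moreover have "L2_inner \<Omega> H G = - L2_inner \<Omega> h w"
    using H(1) L(2) H(3) G(2) by (rule weak_laplacian_green[OF \<Omega>])
  ultimately show ?thesis by (simp add: L2_inner_commute)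
qed

lemma dirichlet_laplacian_L2:
  assumes "dirichlet_laplacian \<Omega> w g"
  shows "w \<in> L2 \<Omega>" "g \<in> L2 \<Omega>"
  using assms by (auto simp: dirichlet_laplacian_def H10_gradient_def H1_gradient_def)

text \<open>By symmetry the Laplacian moves onto the eigenfunction, so it acts on the expansion
  coefficients as multiplication by -\<mu>.\<close>

lemma dirichlet_laplacian_eigen:
  assumes "bounded \<Omega>" "open \<Omega>" "dirichlet_laplacian \<Omega> w g" "dirichlet_eigenfunction \<Omega> \<mu> \<phi>"
  shows "L2_inner \<Omega> g \<phi> = - \<mu> * L2_inner \<Omega> w \<phi>"
proof -
  have "dirichlet_laplacian \<Omega> \<phi> (\<lambda>x. - \<mu> * \<phi> x)"
    using assms(4) by (simp add: dirichlet_eigenfunction_def)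
  then have "L2_inner \<Omega> g \<phi> = L2_inner \<Omega> w (\<lambda>x. - \<mu> * \<phi> x)"
    by (rule dirichlet_laplacian_symmetric[OF assms(1-3)])
  also have "\<dots> = - \<mu> * L2_inner \<Omega> w \<phi>"
    unfolding L2_inner_commute[of \<Omega> w] by (rule L2_inner_mult_left)
  finally show ?thesis .
qed

text \<open>Parseval turns the claim into a comparison of two series term by term, each \<mu> j
  being at least \<open>lambda1\<close>. Stating it for a difference avoids proving that the graph
  of the Laplacian is closed under subtraction: linearity is needed only for the
  coefficients.\<close>

lemma dirichlet_laplacian_diff_le:
  assumes \<Omega>: "bounded \<Omega>" "open \<Omega>" "dirichlet_spectral_basis \<Omega>"
    and min: "\<forall>\<mu>\<in>dirichlet_eigenvalues \<Omega>. lambda1 \<le> \<mu>"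
    and w1: "dirichlet_laplacian \<Omega> w1 g1" and w2: "dirichlet_laplacian \<Omega> w2 g2"
  defines "w \<equiv> \<lambda>x. w1 x - w2 x" and "g \<equiv> \<lambda>x. g1 x - g2 x"
  shows "L2_inner \<Omega> g w \<le> - lambda1 * L2_inner \<Omega> w w"
proof -
  obtain \<mu> \<phi> where eig: "\<And>j::nat. dirichlet_eigenfunction \<Omega> (\<mu> j) (\<phi> j)"
    and basis: "L2_orthonormal_basis \<Omega> \<phi>"
    using \<Omega>(3) by (auto simp: dirichlet_spectral_basis_def)
  have \<phi>: "\<phi> j \<in> L2 \<Omega>" for j
    using basis by (simp add: L2_orthonormal_basis_def)
  have mu: "lambda1 \<le> \<mu> j" for j
    using min eig by (auto simp: dirichlet_eigenvalues_def)
  note L = dirichlet_laplacian_L2[OF w1] dirichlet_laplacian_L2[OF w2]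
  have wg: "w \<in> L2 \<Omega>" "g \<in> L2 \<Omega>"
    unfolding w_def g_def using L by (auto intro: L2_diff)
  have coeff: "L2_inner \<Omega> g (\<phi> j) = - \<mu> j * L2_inner \<Omega> w (\<phi> j)" for j
    unfolding w_def g_def
    using L \<phi> dirichlet_laplacian_eigen[OF \<Omega>(1,2) w1 eig, of j]
      dirichlet_laplacian_eigen[OF \<Omega>(1,2) w2 eig, of j]
    by (simp add: L2_inner_diff_left algebra_simps)
  have le: "L2_inner \<Omega> g (\<phi> j) * L2_inner \<Omega> w (\<phi> j)
      \<le> - lambda1 * (L2_inner \<Omega> w (\<phi> j) * L2_inner \<Omega> w (\<phi> j))" for j
    using mult_right_mono[OF mu[of j], of "L2_inner \<Omega> w (\<phi> j) * L2_inner \<Omega> w (\<phi> j)"]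
    by (simp add: coeff mult.assoc)
  have "(\<lambda>j. L2_inner \<Omega> g (\<phi> j) * L2_inner \<Omega> w (\<phi> j)) sums L2_inner \<Omega> g w"
    by (rule L2_basis_inner_sums[OF basis wg(2,1)])
  moreover have "(\<lambda>j. - lambda1 * (L2_inner \<Omega> w (\<phi> j) * L2_inner \<Omega> w (\<phi> j)))
      sums (- lambda1 * L2_inner \<Omega> w w)"
    by (intro sums_mult L2_basis_inner_sums[OF basis] wg)
  ultimately show ?thesis
    by (rule sums_le[OF le])
qed

section \<open>Stability of one time step\<close>

text \<open>The squared norms of a and b differ by the integral of (a - b)(a + b), which is 2\<tau>
  times the inner product of q and w. This is the unconditional stability of the midpoint rule for a
  dissipative operator.\<close>

lemma L2_norm_le_of_dissipative:
  fixes a b w q :: "'a::euclidean_space \<Rightarrow> real"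
  assumes L: "a \<in> L2 \<Omega>" "b \<in> L2 \<Omega>" "w \<in> L2 \<Omega>" "q \<in> L2 \<Omega>" and "0 \<le> \<tau>"
    and sum: "AE x in lebesgue_on \<Omega>. a x + b x = 2 * w x"
    and diff: "AE x in lebesgue_on \<Omega>. a x - b x = \<tau> * q x"
    and diss: "L2_inner \<Omega> q w \<le> 0"
  shows "L2_norm \<Omega> a \<le> L2_norm \<Omega> b"
proof -
  have "L2_inner \<Omega> a a - L2_inner \<Omega> b b = (LINT x|lebesgue_on \<Omega>. a x * a x - b x * b x)"
    using L integrable_L2_inner[OF L(1,1)] integrable_L2_inner[OF L(2,2)]
    by (simp add: L2_inner_def)
  also have "\<dots> = (LINT x|lebesgue_on \<Omega>. (2 * \<tau>) * (q x * w x))"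
  proof (rule integral_cong_AE)
    show "AE x in lebesgue_on \<Omega>. a x * a x - b x * b x = (2 * \<tau>) * (q x * w x)"
      using sum diff
    proof eventually_elim
      case (elim x)
      have "a x * a x - b x * b x = (a x - b x) * (a x + b x)"
        by (simp add: algebra_simps)
      then show ?case using elim by simp
    qed
  qed (use L[THEN L2_measurable] in measurable)
  also have "\<dots> = 2 * \<tau> * L2_inner \<Omega> q w"
    by (simp add: L2_inner_def)
  also have "\<dots> \<le> 0"
    using diss \<open>0 \<le> \<tau>\<close> by (simp add: mult_nonneg_nonpos)
  finally show ?thesis
    by (simp add: L2_norm_def)
qed

text \<open>Here \<open>up\<close>, \<open>um\<close> and \<open>uh\<close> are the exact solution
  at the right end, left end and midpoint of a step, and \<open>ut\<close> and \<open>F\<close> are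
  its time derivative and the source at the midpoint. Of the exact solution only \<open>uh\<close>
  must lie in the domain of the Laplacian, so the step starting from the rough initial value is
  covered too.\<close>

lemma crank_nicolson_step:
  fixes up um uh ut Up Um F :: "'a::euclidean_space \<Rightarrow> real"
  assumes \<Omega>: "bounded \<Omega>" "open \<Omega>" "dirichlet_spectral_basis \<Omega>"
    and min: "\<forall>\<mu>\<in>dirichlet_eigenvalues \<Omega>. lambda1 \<le> \<mu>" and "\<kappa> \<le> lambda1" "0 < \<tau>"
    and L: "up \<in> L2 \<Omega>" "um \<in> L2 \<Omega>" "ut \<in> L2 \<Omega>" "Up \<in> L2 \<Omega>" "Um \<in> L2 \<Omega>"
    and lap_u: "dirichlet_laplacian \<Omega> uh g1"
    and eq_u: "AE x in lebesgue_on \<Omega>. ut x - g1 x = \<kappa> * uh x + F x"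
    and lap_U: "dirichlet_laplacian \<Omega> (\<lambda>x. (Up x + Um x) / 2) g2"
    and eq_U: "AE x in lebesgue_on \<Omega>.
      (Up x - Um x) / \<tau> = g2 x + \<kappa> * ((Up x + Um x) / 2) + F x"
  shows "L2_norm \<Omega> (\<lambda>x. up x - Up x) \<le> L2_norm \<Omega> (\<lambda>x. um x - Um x)
    + 2 * L2_norm \<Omega> (\<lambda>x. (up x + um x) / 2 - uh x)
    + L2_norm \<Omega> (\<lambda>x. up x - um x - \<tau> * ut x)"
proof -
  define R where "R = (\<lambda>x. (up x + um x) / 2 - uh x)"
  define \<rho> where "\<rho> = (\<lambda>x. up x - um x - \<tau> * ut x)"
  define w where "w = (\<lambda>x. uh x - (Up x + Um x) / 2)"
  define g where "g = (\<lambda>x. g1 x - g2 x)"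
  define q where "q = (\<lambda>x. g x + \<kappa> * w x)"
  \<comment> \<open>Half of \<rho> is charged to each end with opposite signs: \<rho> then cancels
    in a + b and R cancels in a - b. The two corrections together cost at most
    \<open>2 * L2_norm \<Omega> R + L2_norm \<Omega> \<rho>\<close>.\<close>
  define p where "p = (\<lambda>x. R x + 1/2 * \<rho> x)"
  define r where "r = (\<lambda>x. R x - 1/2 * \<rho> x)"
  define a where "a = (\<lambda>x. (up x - Up x) - p x)"
  define b where "b = (\<lambda>x. (um x - Um x) - r x)"
  note LL = dirichlet_laplacian_L2[OF lap_u] dirichlet_laplacian_L2[OF lap_U] L
  have wg: "w \<in> L2 \<Omega>" "g \<in> L2 \<Omega>"
    unfolding w_def g_def using LL by (auto intro!: L2_diff)
  have Rr: "R \<in> L2 \<Omega>" "\<rho> \<in> L2 \<Omega>"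
    unfolding R_def \<rho>_def using LL by (auto intro!: L2_diff L2_add L2_divide L2_mult)
  have pr: "p \<in> L2 \<Omega>" "r \<in> L2 \<Omega>"
    unfolding p_def r_def by (intro L2_add L2_diff L2_mult Rr)+
  have q: "q \<in> L2 \<Omega>"
    unfolding q_def by (intro L2_add L2_mult wg)
  have e: "(\<lambda>x. up x - Up x) \<in> L2 \<Omega>" "(\<lambda>x. um x - Um x) \<in> L2 \<Omega>"
    using L by (auto intro: L2_diff)
  have ab: "a \<in> L2 \<Omega>" "b \<in> L2 \<Omega>"
    unfolding a_def b_def using e pr by (auto intro: L2_diff)
  have "L2_inner \<Omega> q w = L2_inner \<Omega> g w + \<kappa> * L2_inner \<Omega> w w"
    unfolding q_def using wg by (simp add: L2_inner_add_left L2_mult L2_inner_mult_left)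
  moreover have "L2_inner \<Omega> g w \<le> - lambda1 * L2_inner \<Omega> w w"
    unfolding g_def w_def by (rule dirichlet_laplacian_diff_le[OF \<Omega> min lap_u lap_U])
  moreover have "\<kappa> * L2_inner \<Omega> w w \<le> lambda1 * L2_inner \<Omega> w w"
    using \<open>\<kappa> \<le> lambda1\<close> L2_inner_self_nonneg by (rule mult_right_mono)
  ultimately have diss: "L2_inner \<Omega> q w \<le> 0" by simp
  have "L2_norm \<Omega> a \<le> L2_norm \<Omega> b"
  proof (rule L2_norm_le_of_dissipative[OF ab wg(1) q _ _ _ diss])
    show "0 \<le> \<tau>" using \<open>0 < \<tau>\<close> by simp
    show "AE x in lebesgue_on \<Omega>. a x + b x = 2 * w x"
      by (simp add: a_def b_def p_def r_def R_def w_def field_simps)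
    show "AE x in lebesgue_on \<Omega>. a x - b x = \<tau> * q x"
      using eq_u eq_U
    proof eventually_elim
      case (elim x)
      have "Up x - Um x = \<tau> * ((Up x - Um x) / \<tau>)"
        using \<open>0 < \<tau>\<close> by simp
      also have "\<dots> = \<tau> * (g2 x + \<kappa> * ((Up x + Um x) / 2) + F x)"
        by (simp only: elim)
      finally have 1: "Up x - Um x = \<tau> * (g2 x + \<kappa> * ((Up x + Um x) / 2) + F x)" .
      \<comment> \<open>Scheme and equation are sampled at the same midpoint, so the source can be
        eliminated between them.\<close>
      have 2: "F x = ut x - g1 x - \<kappa> * uh x" using elim by simp
      have "a x - b x = \<tau> * ut x - (Up x - Um x)"
        by (simp add: a_def b_def p_def r_def \<rho>_def)
      also have "\<dots> = \<tau> * q x"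
        unfolding 1 2 by (simp add: q_def g_def w_def algebra_simps)
      finally show ?case .
    qed
  qed
  moreover have "L2_norm \<Omega> (\<lambda>x. up x - Up x) \<le> L2_norm \<Omega> a + L2_norm \<Omega> p"
    using L2_norm_triangle[OF ab(1) pr(1)] by (simp add: a_def)
  moreover have "L2_norm \<Omega> b \<le> L2_norm \<Omega> (\<lambda>x. um x - Um x) + L2_norm \<Omega> r"
    unfolding b_def by (rule L2_norm_triangle_diff[OF e(2) pr(2)])
  moreover have "L2_norm \<Omega> p \<le> L2_norm \<Omega> R + 1/2 * L2_norm \<Omega> \<rho>"
    using L2_norm_triangle[OF Rr(1) L2_mult[OF Rr(2), of "1/2"]] L2_norm_mult[of \<Omega> "1/2" \<rho>]
    by (simp add: p_def)
  moreover have "L2_norm \<Omega> r \<le> L2_norm \<Omega> R + 1/2 * L2_norm \<Omega> \<rho>"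
    using L2_norm_triangle_diff[OF Rr(1) L2_mult[OF Rr(2), of "1/2"]]
      L2_norm_mult[of \<Omega> "1/2" \<rho>]
    by (simp add: r_def)
  ultimately show ?thesis
    by (simp add: R_def \<rho>_def)
qed

section \<open>Consistency errors\<close>

text \<open>Norm convergence of the difference quotients survives pairing with \<psi>, and the
  pairing commutes with the quotient by linearity.\<close>

lemma L2_inner_has_derivative:
  assumes v: "L2_has_derivative_on \<Omega> I v v'" and t: "t \<in> I" and \<psi>: "\<psi> \<in> L2 \<Omega>"
  shows "((\<lambda>s. L2_inner \<Omega> (v s) \<psi>) has_real_derivative L2_inner \<Omega> (v' t) \<psi>) (at t within I)"
proof -
  have vL: "\<And>s. s \<in> I \<Longrightarrow> v s \<in> L2 \<Omega>" and v'L: "v' t \<in> L2 \<Omega>"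
    and lim: "((\<lambda>s. L2_norm \<Omega> (\<lambda>x. (v s x - v t x) / (s - t) - v' t x)) \<longlongrightarrow> 0) (at t within I)"
    using v t by (auto simp: L2_has_derivative_on_def)
  have ev: "eventually (\<lambda>s. s \<in> I) (at t within I)"
    by (simp add: eventually_at_filter)
  have "((\<lambda>s. L2_inner \<Omega> (\<lambda>x. (v s x - v t x) / (s - t)) \<psi>) \<longlongrightarrow> L2_inner \<Omega> (v' t) \<psi>)
      (at t within I)"
    using ev vL[OF t] vL
    by (intro L2_inner_tendsto[OF \<psi> v'L _ lim]) (auto elim!: eventually_mono intro!: L2_divide L2_diff)
  moreover have "\<forall>\<^sub>F s in at t within I. L2_inner \<Omega> (\<lambda>x. (v s x - v t x) / (s - t)) \<psi>
      = (L2_inner \<Omega> (v s) \<psi> - L2_inner \<Omega> (v t) \<psi>) / (s - t)"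
    using ev by eventually_elim (simp add: L2_inner_divide_left L2_inner_diff_left vL t \<psi>)
  ultimately have "((\<lambda>s. (L2_inner \<Omega> (v s) \<psi> - L2_inner \<Omega> (v t) \<psi>) / (s - t))
      \<longlongrightarrow> L2_inner \<Omega> (v' t) \<psi>) (at t within I)"
    by (simp add: tendsto_cong)
  then show ?thesis
    by (simp add: has_field_derivative_iff)
qed

section \<open>Taylor estimates away from the initial time\<close>

text \<open>Expansion about the midpoint, with \<open>h i\<close> as i-th derivative and half-length
  d: the linear terms cancel in the average and the quadratic ones in the difference.
  \<open>field_Taylor\<close> divides the remainder of order n + 1 by n! only, so the two remainders
  add up to \<open>B2 * d\<^sup>2\<close> and \<open>B3 * d ^ 3\<close>, which explains 1/4 and
  1/8.\<close>

lemma midpoint_taylor: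
  fixes h :: "nat \<Rightarrow> real \<Rightarrow> real"
  assumes "a \<le> b"
    and der: "\<And>i t. t \<in> {a..b} \<Longrightarrow> i \<le> 2 \<Longrightarrow>
      (h i has_real_derivative h (Suc i) t) (at t within {a..b})"
    and B2: "\<And>t. t \<in> {a..b} \<Longrightarrow> \<bar>h 2 t\<bar> \<le> B2"
    and B3: "\<And>t. t \<in> {a..b} \<Longrightarrow> \<bar>h 3 t\<bar> \<le> B3"
  shows "\<bar>(h 0 b + h 0 a) / 2 - h 0 ((a + b) / 2)\<bar> \<le> B2 * (b - a)\<^sup>2 / 4"
    and "\<bar>h 0 b - h 0 a - (b - a) * h 1 ((a + b) / 2)\<bar> \<le> B3 * (b - a) ^ 3 / 8"
proof -
  define m where "m = (a + b) / 2"
  define d where "d = (b - a) / 2"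
  have m: "m \<in> {a..b}" and ab: "a \<in> {a..b}" "b \<in> {a..b}" and d: "b - m = d" "a - m = - d" "0 \<le> d"
    using assms(1) by (auto simp: m_def d_def field_simps)
  have t1: "\<bar>h 0 z - (h 0 m + h 1 m * (z - m))\<bar> \<le> B2 * \<bar>z - m\<bar>\<^sup>2" if "z \<in> {a..b}" for z
    using field_Taylor[of "{a..b}" 1 h B2 m z] der B2 m that
    by (simp add: numeral_2_eq_2)
  have t2: "\<bar>h 0 z - (h 0 m + h 1 m * (z - m) + h 2 m * (z - m)\<^sup>2 / 2)\<bar> \<le> B3 * \<bar>z - m\<bar> ^ 3 / 2"
    if "z \<in> {a..b}" for z
    using field_Taylor[of "{a..b}" 2 h B3 m z] der B3 m that
    by (simp add: numeral_2_eq_2 numeral_3_eq_3)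
  have "\<bar>(h 0 b + h 0 a) / 2 - h 0 m\<bar> \<le> B2 * d\<^sup>2"
    using t1[OF ab(1)] t1[OF ab(2)] unfolding d using d(3) by (simp add: abs_le_iff field_simps)
  then show "\<bar>(h 0 b + h 0 a) / 2 - h 0 ((a + b) / 2)\<bar> \<le> B2 * (b - a)\<^sup>2 / 4"
    by (simp add: m_def d_def power_divide)
  have *: "\<bar>h 0 b - h 0 a - (2 * d) * h 1 m\<bar> \<le> B3 * d ^ 3"
  proof -
    have "\<bar>h 0 a - (h 0 m - h 1 m * d + h 2 m * d\<^sup>2 / 2)\<bar> \<le> B3 * d ^ 3 / 2"
      "\<bar>h 0 b - (h 0 m + h 1 m * d + h 2 m * d\<^sup>2 / 2)\<bar> \<le> B3 * d ^ 3 / 2"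
      using t2[OF ab(1)] t2[OF ab(2)] d(3) by (simp_all add: d)
    then show ?thesis
      unfolding abs_le_iff mult.assoc mult.commute[of d] by linarith
  qed
  show "\<bar>h 0 b - h 0 a - (b - a) * h 1 ((a + b) / 2)\<bar> \<le> B3 * (b - a) ^ 3 / 8"
  proof -
    have "2 * d = b - a" "d ^ 3 = (b - a) ^ 3 / 8"
      by (simp_all add: d_def power_divide)
    with * show ?thesis by (simp add: m_def)
  qed
qed

lemma L2_Cm_on_L2:
  assumes "L2_Cm_on \<Omega> I m v D" "k \<le> m" "t \<in> I"
  shows "D k t \<in> L2 \<Omega>"
  using assms
  by (cases "k = m") (auto simp: L2_Cm_on_def L2_has_derivative_on_def L2_continuous_on_def)

text \<open>The scalar estimate is applied to the pairings with each \<psi>, whose derivatives are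
  bounded by Cauchy-Schwarz, and duality then removes \<psi>.\<close>

lemma L2_midpoint_taylor:
  fixes \<Omega> :: "'a::euclidean_space set"
  assumes u: "L2_Cm_on \<Omega> I 3 u ut" and ab: "a \<le> b" "{a..b} \<subseteq> I"
    and B2: "\<And>t. t \<in> {a..b} \<Longrightarrow> L2_norm \<Omega> (ut 2 t) \<le> B2"
    and B3: "\<And>t. t \<in> {a..b} \<Longrightarrow> L2_norm \<Omega> (ut 3 t) \<le> B3"
  shows "L2_norm \<Omega> (\<lambda>x. (u b x + u a x) / 2 - u ((a + b) / 2) x) \<le> B2 * (b - a)\<^sup>2 / 4"
    and "L2_norm \<Omega> (\<lambda>x. u b x - u a x - (b - a) * ut 1 ((a + b) / 2) x) \<le> B3 * (b - a) ^ 3 / 8"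
proof -
  have u0: "u = ut 0" using u by (simp add: L2_Cm_on_def)
  have m: "(a + b) / 2 \<in> {a..b}" using ab by (auto simp: field_simps)
  have L: "ut k t \<in> L2 \<Omega>" if "k \<le> 3" "t \<in> {a..b}" for k t
    using L2_Cm_on_L2[OF u that(1)] that(2) ab by auto
  have pos: "0 \<le> B2" "0 \<le> B3"
    using L2_norm_nonneg B2[OF m] B3[OF m] order_trans by blast+
  have uL: "u b \<in> L2 \<Omega>" "u a \<in> L2 \<Omega>" "u ((a + b) / 2) \<in> L2 \<Omega>" "ut 1 ((a + b) / 2) \<in> L2 \<Omega>"
    unfolding u0 using ab m by (auto intro!: L)
  have *: "\<bar>(L2_inner \<Omega> (u b) \<psi> + L2_inner \<Omega> (u a) \<psi>) / 2 - L2_inner \<Omega> (u ((a + b) / 2)) \<psi>\<bar>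
        \<le> (B2 * L2_norm \<Omega> \<psi>) * (b - a)\<^sup>2 / 4"
      "\<bar>L2_inner \<Omega> (u b) \<psi> - L2_inner \<Omega> (u a) \<psi> - (b - a) * L2_inner \<Omega> (ut 1 ((a + b) / 2)) \<psi>\<bar>
        \<le> (B3 * L2_norm \<Omega> \<psi>) * (b - a) ^ 3 / 8"
    if \<psi>: "\<psi> \<in> L2 \<Omega>" for \<psi> :: "'a \<Rightarrow> real"
  proof -
    define h where "h = (\<lambda>k t. L2_inner \<Omega> (ut k t) \<psi>)"
    have der: "(h i has_real_derivative h (Suc i) t) (at t within {a..b})"
      if "t \<in> {a..b}" "i \<le> 2" for i t
    proof -
      have "L2_has_derivative_on \<Omega> I (ut i) (ut (Suc i))"
        using u that(2) by (simp add: L2_Cm_on_def)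
      then have "(h i has_real_derivative h (Suc i) t) (at t within I)"
        unfolding h_def using that(1) ab \<psi> by (intro L2_inner_has_derivative) auto
      then show ?thesis using ab(2) by (rule DERIV_subset)
    qed
    have b2: "\<bar>h 2 t\<bar> \<le> B2 * L2_norm \<Omega> \<psi>" if "t \<in> {a..b}" for t
      unfolding h_def using L2_Cauchy_Schwarz[OF L[OF _ that, of 2] \<psi>]
        mult_right_mono[OF B2[OF that] L2_norm_nonneg[of \<Omega> \<psi>]] by simp
    have b3: "\<bar>h 3 t\<bar> \<le> B3 * L2_norm \<Omega> \<psi>" if "t \<in> {a..b}" for t
      unfolding h_def using L2_Cauchy_Schwarz[OF L[OF _ that, of 3] \<psi>]
        mult_right_mono[OF B3[OF that] L2_norm_nonneg[of \<Omega> \<psi>]] by simp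
    show "\<bar>(L2_inner \<Omega> (u b) \<psi> + L2_inner \<Omega> (u a) \<psi>) / 2 - L2_inner \<Omega> (u ((a + b) / 2)) \<psi>\<bar>
        \<le> (B2 * L2_norm \<Omega> \<psi>) * (b - a)\<^sup>2 / 4"
      using midpoint_taylor(1)[of a b h, OF ab(1) der b2 b3] by (simp add: h_def u0)
    show "\<bar>L2_inner \<Omega> (u b) \<psi> - L2_inner \<Omega> (u a) \<psi> - (b - a) * L2_inner \<Omega> (ut 1 ((a + b) / 2)) \<psi>\<bar>
        \<le> (B3 * L2_norm \<Omega> \<psi>) * (b - a) ^ 3 / 8"
      using midpoint_taylor(2)[of a b h, OF ab(1) der b2 b3] by (simp add: h_def u0)
  qed
  show "L2_norm \<Omega> (\<lambda>x. (u b x + u a x) / 2 - u ((a + b) / 2) x) \<le> B2 * (b - a)\<^sup>2 / 4"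
  proof (rule L2_norm_le_dual)
    show "(\<lambda>x. (u b x + u a x) / 2 - u ((a + b) / 2) x) \<in> L2 \<Omega>"
      by (intro L2_diff L2_divide L2_add uL)
    fix \<psi> :: "'a \<Rightarrow> real" assume "\<psi> \<in> L2 \<Omega>"
    then show "\<bar>L2_inner \<Omega> (\<lambda>x. (u b x + u a x) / 2 - u ((a + b) / 2) x) \<psi>\<bar>
        \<le> B2 * (b - a)\<^sup>2 / 4 * L2_norm \<Omega> \<psi>"
      using *(1)[of \<psi>] uL
      by (simp add: L2_inner_diff_left L2_inner_add_left L2_inner_divide_left L2_divide L2_add
          mult.commute mult.left_commute)
  qed (use pos in simp)
  show "L2_norm \<Omega> (\<lambda>x. u b x - u a x - (b - a) * ut 1 ((a + b) / 2) x) \<le> B3 * (b - a) ^ 3 / 8"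
  proof (rule L2_norm_le_dual)
    show "(\<lambda>x. u b x - u a x - (b - a) * ut 1 ((a + b) / 2) x) \<in> L2 \<Omega>"
      by (intro L2_diff L2_mult uL)
    fix \<psi> :: "'a \<Rightarrow> real" assume "\<psi> \<in> L2 \<Omega>"
    then show "\<bar>L2_inner \<Omega> (\<lambda>x. u b x - u a x - (b - a) * ut 1 ((a + b) / 2) x) \<psi>\<bar>
        \<le> B3 * (b - a) ^ 3 / 8 * L2_norm \<Omega> \<psi>"
      using *(2)[of \<psi>] uL
      by (simp add: L2_inner_diff_left L2_inner_mult_left L2_mult L2_diff
          mult.commute mult.left_commute)
  qed (use pos ab in simp)
qed

section \<open>Hoelder continuity at the initial time\<close>

text \<open>Subtracting the antiderivative \<open>B / \<alpha> * t powr \<alpha>\<close> of the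
  bound leaves a function that is nonincreasing on the open interval and continuous up to 0. The
  singularity of the derivative at 0 is thus handled without integration.\<close>

lemma diff_le_powr_of_deriv_le:
  fixes h :: "real \<Rightarrow> real"
  assumes "0 \<le> s" "0 < \<alpha>" and cont: "continuous_on {0..s} h"
    and der: "\<And>t. 0 < t \<Longrightarrow> t < s \<Longrightarrow> (h has_real_derivative h' t) (at t)"
    and B: "\<And>t. 0 < t \<Longrightarrow> t < s \<Longrightarrow> h' t \<le> B * t powr (\<alpha> - 1)"
  shows "h s - h 0 \<le> B / \<alpha> * s powr \<alpha>"
proof -
  have "h s - B / \<alpha> * s powr \<alpha> \<le> h 0 - B / \<alpha> * 0 powr \<alpha>"
  proof (rule DERIV_nonpos_imp_decreasing_open[OF \<open>0 \<le> s\<close>])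
    fix t assume t: "0 < t" "t < s"
    have "((\<lambda>t. h t - B / \<alpha> * t powr \<alpha>) has_real_derivative
        h' t - B / \<alpha> * (\<alpha> * t powr (\<alpha> - 1))) (at t)"
      using t by (intro DERIV_diff der DERIV_cmult has_real_derivative_powr)
    then show "\<exists>y. ((\<lambda>t. h t - B / \<alpha> * t powr \<alpha>) has_real_derivative y) (at t) \<and> y \<le> 0"
      using B[OF t] \<open>0 < \<alpha>\<close> by (intro exI conjI) auto
  next
    show "continuous_on {0..s} (\<lambda>t. h t - B / \<alpha> * t powr \<alpha>)"
      using \<open>0 < \<alpha>\<close> by (intro continuous_intros cont continuous_on_powr') auto
  qed
  then show ?thesis by simp
qed

lemma L2_diff_le_powr:
  fixes \<Omega> :: "'a::euclidean_space set"
  assumes cont: "L2_continuous_on \<Omega> {0..T} u"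
    and der: "L2_has_derivative_on \<Omega> {0<..T} u u'"
    and B: "\<And>t. t \<in> {0<..T} \<Longrightarrow> L2_norm \<Omega> (u' t) \<le> M * t powr (\<alpha> - 1)"
    and "0 < \<alpha>" "0 \<le> M" and s: "s \<in> {0..T}"
  shows "L2_norm \<Omega> (\<lambda>x. u s x - u 0 x) \<le> M / \<alpha> * s powr \<alpha>"
proof -
  have L: "u t \<in> L2 \<Omega>" if "t \<in> {0..T}" for t
    using cont that by (simp add: L2_continuous_on_def)
  have L0: "u s \<in> L2 \<Omega>" "u 0 \<in> L2 \<Omega>" using s by (auto intro!: L)
  have ineq: "L2_inner \<Omega> (u s) \<psi> - L2_inner \<Omega> (u 0) \<psi> \<le> M / \<alpha> * s powr \<alpha> * L2_norm \<Omega> \<psi>"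
    if \<psi>: "\<psi> \<in> L2 \<Omega>" for \<psi> :: "'a \<Rightarrow> real"
  proof -
    have "L2_inner \<Omega> (u s) \<psi> - L2_inner \<Omega> (u 0) \<psi> \<le> (M * L2_norm \<Omega> \<psi>) / \<alpha> * s powr \<alpha>"
    proof (rule diff_le_powr_of_deriv_le[OF _ \<open>0 < \<alpha>\<close>])
      show "0 \<le> s" using s by simp
      have "continuous_on {0..T} (\<lambda>t. L2_inner \<Omega> (u t) \<psi>)"
        unfolding continuous_on_def
      proof
        fix t assume t: "t \<in> {0..T}"
        have "\<forall>\<^sub>F s in at t within {0..T}. u s \<in> L2 \<Omega>"
          using L by (simp add: eventually_at_filter)
        then show "((\<lambda>t. L2_inner \<Omega> (u t) \<psi>) \<longlongrightarrow> L2_inner \<Omega> (u t) \<psi>) (at t within {0..T})"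
          using cont t by (intro L2_inner_tendsto[OF \<psi> L[OF t]]) (auto simp: L2_continuous_on_def)
      qed
      then show "continuous_on {0..s} (\<lambda>t. L2_inner \<Omega> (u t) \<psi>)"
        using s by (auto intro: continuous_on_subset)
      fix t assume t: "0 < t" "t < s"
      \<comment> \<open>Passing to the open interval turns the derivative within
        \<open>{0<..T}\<close> into a two-sided one.\<close>
      then have tI: "t \<in> {0<..T}" "t \<in> {0<..<T}" using s by auto
      have "((\<lambda>t. L2_inner \<Omega> (u t) \<psi>) has_real_derivative L2_inner \<Omega> (u' t) \<psi>) (at t within {0<..T})"
        by (rule L2_inner_has_derivative[OF der tI(1) \<psi>])
      then have "((\<lambda>t. L2_inner \<Omega> (u t) \<psi>) has_real_derivative L2_inner \<Omega> (u' t) \<psi>)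
          (at t within {0<..<T})"
        by (rule DERIV_subset) auto
      then show "((\<lambda>t. L2_inner \<Omega> (u t) \<psi>) has_real_derivative L2_inner \<Omega> (u' t) \<psi>) (at t)"
        using tI by (simp add: at_within_open[of t "{0<..<T}"])
      have "u' t \<in> L2 \<Omega>" using der tI by (simp add: L2_has_derivative_on_def)
      from L2_Cauchy_Schwarz[OF this \<psi>]
      have "L2_inner \<Omega> (u' t) \<psi> \<le> L2_norm \<Omega> (u' t) * L2_norm \<Omega> \<psi>" by simp
      also have "\<dots> \<le> M * t powr (\<alpha> - 1) * L2_norm \<Omega> \<psi>"
        by (rule mult_right_mono[OF B[OF tI(1)] L2_norm_nonneg])
      finally show "L2_inner \<Omega> (u' t) \<psi> \<le> M * L2_norm \<Omega> \<psi> * t powr (\<alpha> - 1)"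
        by (simp add: mult_ac)
    qed
    then show ?thesis by (simp add: mult_ac)
  qed
  show ?thesis
  proof (rule L2_norm_le_dual)
    show "(\<lambda>x. u s x - u 0 x) \<in> L2 \<Omega>" by (intro L2_diff L0)
    show "0 \<le> M / \<alpha> * s powr \<alpha>" using assms by simp
    fix \<psi> :: "'a \<Rightarrow> real" assume \<psi>: "\<psi> \<in> L2 \<Omega>"
    \<comment> \<open>The one-sided bound for -\<psi> supplies the other half of the absolute
      value.\<close>
    have "L2_inner \<Omega> (u s) (\<lambda>x. - 1 * \<psi> x) - L2_inner \<Omega> (u 0) (\<lambda>x. - 1 * \<psi> x)
        \<le> M / \<alpha> * s powr \<alpha> * L2_norm \<Omega> (\<lambda>x. - 1 * \<psi> x)"
      by (rule ineq[OF L2_mult[OF \<psi>]])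
    then have "- (L2_inner \<Omega> (u s) \<psi> - L2_inner \<Omega> (u 0) \<psi>) \<le> M / \<alpha> * s powr \<alpha> * L2_norm \<Omega> \<psi>"
      unfolding L2_norm_mult L2_inner_commute[of \<Omega> "u _"] L2_inner_mult_left by simp
    then show "\<bar>L2_inner \<Omega> (\<lambda>x. u s x - u 0 x) \<psi>\<bar> \<le> M / \<alpha> * s powr \<alpha> * L2_norm \<Omega> \<psi>"
      using ineq[OF \<psi>] by (simp add: L2_inner_diff_left[OF L0 \<psi>] abs_le_iff)
  qed
qed

section \<open>Consistency errors of the first and the later steps\<close>

text \<open>The bounds on the second and third derivatives blow up at 0, so Taylor expansion is
  replaced by the Hoelder bound and the bound on \<open>ut 1\<close>. R contributes 3/2 of
  M/\<alpha>, taken twice; \<rho> contributes M/\<alpha> + 2M; this gives 4/\<alpha> + 2.\<close>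

lemma consistency_error_first_step:
  assumes cont: "L2_continuous_on \<Omega> {0..T} u"
    and Cm: "L2_Cm_on \<Omega> {0<..T} 3 u ut"
    and B: "\<And>t. t \<in> {0<..T} \<Longrightarrow> L2_norm \<Omega> (ut 1 t) \<le> M * t powr (\<alpha> - 1)"
    and \<alpha>: "0 < \<alpha>" "\<alpha> < 1" and "0 \<le> M" and \<tau>: "0 < \<tau>" "\<tau> \<le> T"
  shows "2 * L2_norm \<Omega> (\<lambda>x. (u \<tau> x + u 0 x) / 2 - u (\<tau> / 2) x)
      + L2_norm \<Omega> (\<lambda>x. u \<tau> x - u 0 x - \<tau> * ut 1 (\<tau> / 2) x)
    \<le> M * (4 / \<alpha> + 2) * \<tau> powr \<alpha>"
proof -
  have L: "u t \<in> L2 \<Omega>" if "t \<in> {0..T}" for t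
    using cont that by (simp add: L2_continuous_on_def)
  have uL: "u \<tau> \<in> L2 \<Omega>" "u 0 \<in> L2 \<Omega>" "u (\<tau> / 2) \<in> L2 \<Omega>" using \<tau> by (auto intro!: L)
  have utL: "ut 1 (\<tau> / 2) \<in> L2 \<Omega>" using \<tau> by (intro L2_Cm_on_L2[OF Cm]) auto
  have der: "L2_has_derivative_on \<Omega> {0<..T} u (ut 1)"
    using Cm by (auto simp: L2_Cm_on_def dest: spec[of _ 0])
  have hol: "L2_norm \<Omega> (\<lambda>x. u s x - u 0 x) \<le> M / \<alpha> * s powr \<alpha>" if "s \<in> {0..T}" for s
    by (rule L2_diff_le_powr[OF cont der B \<alpha>(1) \<open>0 \<le> M\<close> that])
  have h1: "L2_norm \<Omega> (\<lambda>x. u \<tau> x - u 0 x) \<le> M / \<alpha> * \<tau> powr \<alpha>"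
    using \<tau> by (intro hol) auto
  have "L2_norm \<Omega> (\<lambda>x. u (\<tau> / 2) x - u 0 x) \<le> M / \<alpha> * (\<tau> / 2) powr \<alpha>"
    using \<tau> by (intro hol) auto
  also have "\<dots> \<le> M / \<alpha> * \<tau> powr \<alpha>"
    using \<tau> \<alpha> \<open>0 \<le> M\<close> by (intro mult_left_mono powr_mono2) auto
  finally have h2: "L2_norm \<Omega> (\<lambda>x. u (\<tau> / 2) x - u 0 x) \<le> M / \<alpha> * \<tau> powr \<alpha>" .
  have "L2_norm \<Omega> (\<lambda>x. (u \<tau> x + u 0 x) / 2 - u (\<tau> / 2) x)
      = L2_norm \<Omega> (\<lambda>x. 1/2 * (u \<tau> x - u 0 x) - (u (\<tau> / 2) x - u 0 x))"
    by (rule arg_cong[where f = "L2_norm \<Omega>"]) (simp add: fun_eq_iff field_simps)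
  also have "\<dots> \<le> L2_norm \<Omega> (\<lambda>x. 1/2 * (u \<tau> x - u 0 x)) + L2_norm \<Omega> (\<lambda>x. u (\<tau> / 2) x - u 0 x)"
    by (intro L2_norm_triangle_diff L2_mult L2_diff uL)
  also have "\<dots> \<le> 3 / 2 * (M / \<alpha> * \<tau> powr \<alpha>)"
    unfolding L2_norm_mult using h1 h2 by simp
  finally have R: "L2_norm \<Omega> (\<lambda>x. (u \<tau> x + u 0 x) / 2 - u (\<tau> / 2) x)
    \<le> 3 / 2 * (M / \<alpha> * \<tau> powr \<alpha>)" .
  have "L2_norm \<Omega> (\<lambda>x. u \<tau> x - u 0 x - \<tau> * ut 1 (\<tau> / 2) x)
      \<le> L2_norm \<Omega> (\<lambda>x. u \<tau> x - u 0 x) + L2_norm \<Omega> (\<lambda>x. \<tau> * ut 1 (\<tau> / 2) x)"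
    by (intro L2_norm_triangle_diff L2_mult L2_diff uL utL)
  also have "L2_norm \<Omega> (\<lambda>x. \<tau> * ut 1 (\<tau> / 2) x) = \<tau> * L2_norm \<Omega> (ut 1 (\<tau> / 2))"
    using \<tau> by (simp add: L2_norm_mult)
  also have "\<dots> \<le> \<tau> * (M * (\<tau> / 2) powr (\<alpha> - 1))"
    using \<tau> by (intro mult_left_mono B) auto
  \<comment> \<open>The factor 2 comes from writing \<tau> as twice \<tau>/2.\<close>
  also have "\<dots> = 2 * M * (\<tau> / 2) powr \<alpha>"
    using \<tau> by (simp add: powr_diff)
  also have "\<dots> \<le> 2 * M * \<tau> powr \<alpha>"
    using \<tau> \<alpha> \<open>0 \<le> M\<close> by (intro mult_left_mono powr_mono2) auto
  finally have "L2_norm \<Omega> (\<lambda>x. u \<tau> x - u 0 x - \<tau> * ut 1 (\<tau> / 2) x)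
      \<le> M / \<alpha> * \<tau> powr \<alpha> + 2 * M * \<tau> powr \<alpha>"
    using h1 by linarith
  then have "2 * L2_norm \<Omega> (\<lambda>x. (u \<tau> x + u 0 x) / 2 - u (\<tau> / 2) x)
      + L2_norm \<Omega> (\<lambda>x. u \<tau> x - u 0 x - \<tau> * ut 1 (\<tau> / 2) x)
      \<le> 4 * (M / \<alpha> * \<tau> powr \<alpha>) + 2 * M * \<tau> powr \<alpha>"
    using R by linarith
  also have "\<dots> = M * (4 / \<alpha> + 2) * \<tau> powr \<alpha>"
    by (simp add: algebra_simps)
  finally show ?thesis .
qed

text \<open>The derivative bounds are worst at the left end a = j\<tau>, where each power of \<tau>
  in the Taylor remainders combines with the power of a into \<open>\<tau> powr \<alpha>\<close>
  times a negative power of j.\<close>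

lemma consistency_error_later_step:
  assumes Cm: "L2_Cm_on \<Omega> {0<..T} 3 u ut"
    and B2: "\<And>t. t \<in> {0<..T} \<Longrightarrow> L2_norm \<Omega> (ut 2 t) \<le> M * t powr (\<alpha> - 2)"
    and B3: "\<And>t. t \<in> {0<..T} \<Longrightarrow> L2_norm \<Omega> (ut 3 t) \<le> M * t powr (\<alpha> - 3)"
    and \<alpha>: "\<alpha> < 1" and M: "0 \<le> M" and \<tau>: "0 < \<tau>" and j: "1 \<le> j" "(j + 1) * \<tau> \<le> T"
  defines "a \<equiv> j * \<tau>" and "b \<equiv> (j + 1) * \<tau>"
  shows "2 * L2_norm \<Omega> (\<lambda>x. (u b x + u a x) / 2 - u ((a + b) / 2) x)
      + L2_norm \<Omega> (\<lambda>x. u b x - u a x - \<tau> * ut 1 ((a + b) / 2) x)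
    \<le> M * \<tau> powr \<alpha> * j powr (\<alpha> - 2)"
proof -
  have ab: "0 < a" "a \<le> b" "b - a = \<tau>" "{a..b} \<subseteq> {0<..T}"
  proof -
    show "0 < a" using \<tau> j by (simp add: a_def)
    moreover have "b \<le> T" using j by (simp add: b_def)
    ultimately show "{a..b} \<subseteq> {0<..T}" by auto
    show "a \<le> b" "b - a = \<tau>" using \<tau> by (simp_all add: a_def b_def algebra_simps)
  qed
  have mono: "M * t powr - p \<le> M * a powr - p" if "0 \<le> p" "t \<in> {a..b}" for p t
    using that ab M by (intro mult_left_mono powr_mono2') auto
  have b2: "L2_norm \<Omega> (ut 2 t) \<le> M * a powr (\<alpha> - 2)" if "t \<in> {a..b}" for t
    using B2[of t] mono[of "2 - \<alpha>" t] that ab \<alpha> by (auto intro: order_trans)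
  have b3: "L2_norm \<Omega> (ut 3 t) \<le> M * a powr (\<alpha> - 3)" if "t \<in> {a..b}" for t
    using B3[of t] mono[of "3 - \<alpha>" t] that ab \<alpha> by (auto intro: order_trans)
  note T = L2_midpoint_taylor[OF Cm ab(2,4) b2 b3, unfolded ab(3)]
  have e2: "a powr (\<alpha> - 2) * \<tau>\<^sup>2 = \<tau> powr \<alpha> * j powr (\<alpha> - 2)"
    using \<tau> j by (simp add: a_def powr_mult powr_diff)
  have "a powr (\<alpha> - 3) * \<tau> ^ 3 = \<tau> powr \<alpha> * j powr (\<alpha> - 3)"
    using \<tau> j by (simp add: a_def powr_mult powr_diff)
  also have "\<dots> \<le> \<tau> powr \<alpha> * j powr (\<alpha> - 2)"
    using j by (intro mult_left_mono powr_mono) auto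
  finally have e3: "M * (a powr (\<alpha> - 3) * \<tau> ^ 3) \<le> M * (\<tau> powr \<alpha> * j powr (\<alpha> - 2))"
    using M by (rule mult_left_mono)
  have "0 \<le> M * (\<tau> powr \<alpha> * j powr (\<alpha> - 2))" using M by simp
  \<comment> \<open>The weights add up to 2/4 + 1/8 = 5/8, which is rounded up to 1.\<close>
  then show ?thesis
    using T e3 by (simp add: e2 mult.assoc)
qed

section \<open>The error estimate\<close>

text \<open>The threshold in the case distinction is exactly the time at which
  \<open>2 powr (2 - \<alpha>) * (1 - exp (- 7 * \<delta> * t / 12))\<close> reaches 1.\<close>

lemma C10_nonneg:
  assumes "0 < \<delta>" "\<alpha> < 1"
  shows "0 \<le> C10 \<alpha> \<delta> t"
proof (cases "t > - (12 / (7 * \<delta>)) * ln (1 - 2 powr (\<alpha> - 2))")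
  case True
  have "2 powr (\<alpha> - 2) < (2::real) powr 0"
    using assms by (intro powr_less_mono) auto
  then have pos: "0 < 1 - (2::real) powr (\<alpha> - 2)" by simp
  have "- 7 * \<delta> * t / 12 < ln (1 - 2 powr (\<alpha> - 2))"
    using True assms by (simp add: field_simps)
  then have "exp (- 7 * \<delta> * t / 12) < 1 - 2 powr (\<alpha> - 2)"
    using pos by (metis exp_less_mono exp_ln)
  then have "2 powr (2 - \<alpha>) * 2 powr (\<alpha> - 2) \<le> 2 powr (2 - \<alpha>) * (1 - exp (- 7 * \<delta> * t / 12))"
    by (intro mult_left_mono) auto
  then have "1 \<le> 2 powr (2 - \<alpha>) * (1 - exp (- 7 * \<delta> * t / 12))"
    by (simp flip: powr_add)
  then show ?thesis
    using True assms by (simp add: C10_def)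
qed (simp add: C10_def)

text \<open>The step errors are summed up; since \<alpha> - 2 < -1 the weights form a convergent
  series, whose total bounds the sum for every n and N at once.\<close>

lemma crank_nicolson_uniform_error:
  assumes \<Omega>: "bounded \<Omega>" "open \<Omega>" "dirichlet_spectral_basis \<Omega>"
    and min: "\<forall>\<mu>\<in>dirichlet_eigenvalues \<Omega>. lambda1 \<le> \<mu>" and \<kappa>: "\<kappa> \<le> lambda1"
    and T: "0 < T" and \<alpha>: "0 < \<alpha>" "\<alpha> < 1"
    and sol: "parabolic_solution \<Omega> T \<kappa> f u0 u ut"
    and B: "\<forall>k\<in>{1,2,3}. \<forall>t\<in>{0<..T}. L2_norm \<Omega> (ut k t) \<le> M * t powr (\<alpha> - real k)"
  obtains K where "0 \<le> K" "\<And>N U n. \<lbrakk>1 \<le> N; crank_nicolson \<Omega> \<kappa> f u0 (T / real N) N U; n \<le> N\<rbrakk>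
    \<Longrightarrow> L2_norm \<Omega> (\<lambda>x. u (real n * (T / real N)) x - U n x) \<le> K * (T / real N) powr \<alpha>"
proof
  \<comment> \<open>\<open>d j\<close> weighs the step from j\<tau> to (j + 1)\<tau>. The first
    weight is set by hand because \<open>0 powr (\<alpha> - 2)\<close> is 0.\<close>
  define d :: "nat \<Rightarrow> real" where "d = (\<lambda>j. if j = 0 then 1 else real j powr (\<alpha> - 2))"
  have d0: "0 \<le> d j" for j by (simp add: d_def)
  have "summable (\<lambda>j. real j powr (\<alpha> - 2))"
    using \<alpha> by (simp add: summable_real_powr_iff)
  moreover have "eventually (\<lambda>j. d j = real j powr (\<alpha> - 2)) sequentially"
    using eventually_gt_at_top[of 0] by eventually_elim (simp add: d_def)
  ultimately have sd: "summable d" by (simp add: summable_cong)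
  \<comment> \<open>The constant of the first step; it also dominates the constant M of the later
    ones.\<close>
  define A where "A = M * (4 / \<alpha> + 2)"
  \<comment> \<open>The sign of M is read off from the derivative bound at t = T.\<close>
  have "0 \<le> M * T powr (\<alpha> - 1)"
    using B T L2_norm_nonneg[of \<Omega> "ut 1 T"] by (force intro: order_trans)
  then have M: "0 \<le> M" using T by (simp add: zero_le_mult_iff)
  have A: "0 \<le> A" "M \<le> A"
    using M \<alpha> mult_left_mono[of 1 "4 / \<alpha> + 2" M] by (auto simp: A_def)
  show "0 \<le> A * suminf d"
    using A suminf_nonneg[OF sd d0] by simp
  fix N n :: nat and U
  assume N: "1 \<le> N" and cn: "crank_nicolson \<Omega> \<kappa> f u0 (T / real N) N U" and n: "n \<le> N"
  define \<tau> where "\<tau> = T / real N"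
  have \<tau>: "0 < \<tau>" "real N * \<tau> = T" using N T by (auto simp: \<tau>_def)
  have cont: "L2_continuous_on \<Omega> {0..T} u" and Cm: "L2_Cm_on \<Omega> {0<..T} 3 u ut"
    and eq: "\<And>t. t \<in> {0<..T} \<Longrightarrow> \<exists>g. dirichlet_laplacian \<Omega> (u t) g \<and>
        (AE x in lebesgue_on \<Omega>. ut 1 t x - g x = \<kappa> * u t x + f t x)"
    and init: "AE x in lebesgue_on \<Omega>. u 0 x = u0 x"
    using sol by (auto simp: parabolic_solution_def)
  have UL: "\<And>k. k \<le> N \<Longrightarrow> U k \<in> L2 \<Omega>" and Uinit: "AE x in lebesgue_on \<Omega>. U 0 x = u0 x"
    and scheme: "\<And>k. k \<in> {1..N} \<Longrightarrow> \<exists>g. dirichlet_laplacian \<Omega> (\<lambda>x. (U k x + U (k - 1) x) / 2) g \<and>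
        (AE x in lebesgue_on \<Omega>. (U k x - U (k - 1) x) / \<tau> =
           g x + \<kappa> * ((U k x + U (k - 1) x) / 2) + f ((real k - 1/2) * \<tau>) x)"
    using cn by (auto simp: crank_nicolson_def \<tau>_def)
  have uL: "u t \<in> L2 \<Omega>" if "t \<in> {0..T}" for t
    using cont that by (simp add: L2_continuous_on_def)
  have "L2_norm \<Omega> (\<lambda>x. u (real n * \<tau>) x - U n x) \<le> A * \<tau> powr \<alpha> * (\<Sum>j<n. d j)"
    using n
  proof (induction n)
    case 0
    \<comment> \<open>Both initial values agree with \<open>u0\<close> almost everywhere, so the
      recursion starts from error zero.\<close>
    have "L2_norm \<Omega> (\<lambda>x. u 0 x - U 0 x) = L2_norm \<Omega> (\<lambda>x. 0 :: real)"
    proof (rule L2_norm_cong_AE)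
      show "AE x in lebesgue_on \<Omega>. u 0 x - U 0 x = 0"
        using init Uinit by eventually_elim simp
      show "(\<lambda>x. u 0 x - U 0 x) \<in> L2 \<Omega>"
        using T by (intro L2_diff uL UL) auto
    qed (rule L2_zero)
    also have "\<dots> = 0" by (simp add: L2_norm_def L2_inner_def)
    finally show ?case by simp
  next
    case (Suc j)
    define a where "a = real j * \<tau>"
    define b where "b = (real j + 1) * \<tau>"
    define m where "m = (a + b) / 2"
    have "(real j + 1) * \<tau> \<le> real N * \<tau>"
      using Suc.prems \<tau> by (intro mult_right_mono) auto
    then have bT: "b \<le> T" unfolding b_def \<tau>(2) .
    have ab: "0 \<le> a" "a < b" "b - a = \<tau>" "m = (real (Suc j) - 1/2) * \<tau>"
      using \<tau> by (auto simp: a_def b_def m_def field_simps)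
    have m: "m \<in> {0<..T}" using ab bT by (auto simp: m_def)
    obtain g1 where g1: "dirichlet_laplacian \<Omega> (u m) g1"
      "AE x in lebesgue_on \<Omega>. ut 1 m x - g1 x = \<kappa> * u m x + f m x"
      using eq[OF m] by auto
    obtain g2 where g2: "dirichlet_laplacian \<Omega> (\<lambda>x. (U (Suc j) x + U j x) / 2) g2"
      "AE x in lebesgue_on \<Omega>. (U (Suc j) x - U j x) / \<tau> =
           g2 x + \<kappa> * ((U (Suc j) x + U j x) / 2) + f m x"
      using scheme[of "Suc j"] Suc.prems unfolding ab(4) by auto
    have "L2_norm \<Omega> (\<lambda>x. u b x - U (Suc j) x) \<le> L2_norm \<Omega> (\<lambda>x. u a x - U j x)
      + 2 * L2_norm \<Omega> (\<lambda>x. (u b x + u a x) / 2 - u m x)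
      + L2_norm \<Omega> (\<lambda>x. u b x - u a x - \<tau> * ut 1 m x)"
      using ab bT Suc.prems m
      by (intro crank_nicolson_step[OF \<Omega> min \<kappa> \<tau>(1) _ _ _ _ _ g1 g2] uL UL L2_Cm_on_L2[OF Cm]) auto
    also have "\<dots> \<le> L2_norm \<Omega> (\<lambda>x. u a x - U j x) + A * \<tau> powr \<alpha> * d j"
    proof (cases "j = 0")
      case True
      then have *: "a = 0" "b = \<tau>" "m = \<tau> / 2" "d j = 1"
        by (simp_all add: a_def b_def m_def d_def)
      show ?thesis
        using consistency_error_first_step[OF cont Cm _ \<alpha> M \<tau>(1)] B bT
        unfolding * A_def by simp
    next
      case False
      have "2 * L2_norm \<Omega> (\<lambda>x. (u b x + u a x) / 2 - u m x)
          + L2_norm \<Omega> (\<lambda>x. u b x - u a x - \<tau> * ut 1 m x) \<le> M * \<tau> powr \<alpha> * real j powr (\<alpha> - 2)"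
        unfolding m_def unfolding a_def b_def
        using B False bT
        by (intro consistency_error_later_step[OF Cm _ _ \<alpha>(2) M \<tau>(1)]) (auto simp: b_def)
      also have "\<dots> \<le> A * \<tau> powr \<alpha> * real j powr (\<alpha> - 2)"
        using A by (intro mult_right_mono) auto
      finally show ?thesis using False by (simp add: d_def)
    qed
    also have "\<dots> \<le> A * \<tau> powr \<alpha> * (\<Sum>i<Suc j. d i)"
      using Suc.IH Suc.prems by (simp add: a_def distrib_left)
    finally show ?case by (simp add: b_def add.commute)
  qed
  also have "\<dots> \<le> A * \<tau> powr \<alpha> * suminf d"
    using A by (intro mult_left_mono sum_le_suminf sd d0) auto
  finally show "L2_norm \<Omega> (\<lambda>x. u (real n * (T / real N)) x - U n x)
      \<le> A * suminf d * (T / real N) powr \<alpha>"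
    by (simp add: \<tau>_def mult_ac)
qed

theorem theorem3p2:
  fixes \<Omega> :: "'a::euclidean_space set"
    and T \<alpha> \<kappa> lambda1 M :: real
    and f u :: "real \<Rightarrow> 'a \<Rightarrow> real"
    and u0 :: "'a \<Rightarrow> real"
    and ut :: "nat \<Rightarrow> real \<Rightarrow> 'a \<Rightarrow> real"
  assumes domain: "open \<Omega>" "connected \<Omega>" "\<Omega> \<noteq> {}" "bounded \<Omega>"
    and regular: "dirichlet_spectral_basis \<Omega>"
    and T_pos: "0 < T"
    and alpha: "0 < \<alpha>" "\<alpha> < 1"
    and minimal_eigenvalue: "0 < lambda1" "lambda1 \<in> dirichlet_eigenvalues \<Omega>"
      "\<forall>\<mu>\<in>dirichlet_eigenvalues \<Omega>. lambda1 \<le> \<mu>"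
    and kappa: "\<kappa> < lambda1"
    and solution: "parabolic_solution \<Omega> T \<kappa> f u0 u ut"
    and derivative_bounds:
      "\<forall>k\<in>{1,2,3}. \<forall>t\<in>{0<..T}. L2_norm \<Omega> (ut k t) \<le> M * t powr (\<alpha> - real k)"
  shows "\<exists>C>0. \<forall>N\<ge>1. \<forall>U.
    (let \<tau> = T / real N in
      \<tau> < 1 / (lambda1 - \<kappa>) \<longrightarrow> crank_nicolson \<Omega> \<kappa> f u0 \<tau> N U \<longrightarrow>
      (\<forall>n\<in>{1..N}.
        let t = real n * \<tau>; e = (\<lambda>m x. u (real m * \<tau>) x - U m x) in
        L2_norm \<Omega> (e n) \<le>
          exp (- (lambda1 - \<kappa>) * t) * L2_norm \<Omega> (e 0) +
          C * (C9 \<alpha> (lambda1 - \<kappa>) t * exp (- (lambda1 - \<kappa>) * t / 2) * \<tau> powr \<alpha> +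
               C10 \<alpha> (lambda1 - \<kappa>) t * t powr (\<alpha> - 2) * \<tau>\<^sup>2)))"
proof -
  define \<delta> where "\<delta> = lambda1 - \<kappa>"
  have \<delta>: "0 < \<delta>" using kappa by (simp add: \<delta>_def)
  obtain K where K: "0 \<le> K" and err:
    "\<And>N U n. \<lbrakk>1 \<le> N; crank_nicolson \<Omega> \<kappa> f u0 (T / real N) N U; n \<le> N\<rbrakk>
      \<Longrightarrow> L2_norm \<Omega> (\<lambda>x. u (real n * (T / real N)) x - U n x) \<le> K * (T / real N) powr \<alpha>"
    using crank_nicolson_uniform_error[OF domain(4,1) regular minimal_eigenvalue(3)
        less_imp_le[OF kappa] T_pos alpha solution derivative_bounds] by blast
  \<comment> \<open>A lower bound for
    \<open>C9 \<alpha> \<delta> t * exp (- \<delta> * t / 2)\<close> on [0,T]: the positive second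
    term of \<open>C9\<close> is dropped and the exponential is taken at t = T.\<close>
  define c where "c = 9 / (2 - \<alpha>) * exp (- \<delta> * T / 2)"
  have c: "0 < c" using alpha by (simp add: c_def)
  \<comment> \<open>Adding 1 keeps C positive when K = 0.\<close>
  define C where "C = (K + 1) / c"
  have C: "0 < C" "K \<le> C * c" using K c by (auto simp: C_def)
  have "L2_norm \<Omega> (\<lambda>x. u (real n * (T / real N)) x - U n x) \<le>
      exp (- \<delta> * t) * L2_norm \<Omega> (\<lambda>x. u (real 0 * (T / real N)) x - U 0 x) +
      C * (C9 \<alpha> \<delta> t * exp (- \<delta> * t / 2) * (T / real N) powr \<alpha> +
        C10 \<alpha> \<delta> t * t powr (\<alpha> - 2) * (T / real N)\<^sup>2)"
    if N: "1 \<le> N" and cn: "crank_nicolson \<Omega> \<kappa> f u0 (T / real N) N U" and n: "n \<in> {1..N}"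
      and t: "t = real n * (T / real N)" for N U n t
  proof -
    have "t \<le> T"
      using mult_right_mono[of "real n" "real N" "T / real N"] n N T_pos by (simp add: t)
    then have "exp (- \<delta> * T / 2) \<le> exp (- \<delta> * t / 2)"
      using \<delta> by simp
    moreover have "9 / (2 - \<alpha>) \<le> C9 \<alpha> \<delta> t"
      by (simp add: C9_def)
    ultimately have "c \<le> C9 \<alpha> \<delta> t * exp (- \<delta> * t / 2)"
      unfolding c_def using alpha by (intro mult_mono) (auto intro: order_trans[rotated])
    then have "C * c \<le> C * (C9 \<alpha> \<delta> t * exp (- \<delta> * t / 2))"
      using C by simp
    with C(2) have "K \<le> C * (C9 \<alpha> \<delta> t * exp (- \<delta> * t / 2))" by linarith
    then have "K * (T / real N) powr \<alpha> \<le> C * (C9 \<alpha> \<delta> t * exp (- \<delta> * t / 2)) * (T / real N) powr \<alpha>"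
      by (intro mult_right_mono) auto
    moreover have "0 \<le> C * (C10 \<alpha> \<delta> t * t powr (\<alpha> - 2) * (T / real N)\<^sup>2)"
      using C C10_nonneg[OF \<delta> alpha(2)] by simp
    moreover have "0 \<le> exp (- \<delta> * t) * L2_norm \<Omega> (\<lambda>x. u (real 0 * (T / real N)) x - U 0 x)"
      by (intro mult_nonneg_nonneg L2_norm_nonneg) simp
    ultimately show ?thesis
      using err[OF N cn, of n] n by (simp add: distrib_left mult.assoc)
  qed
  then show ?thesis
    unfolding \<delta>_def[symmetric] Let_def using C(1) by blast
qed

end
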